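(* For $n\in\mathbb{N}$ let $\Omega(n)$ denote the number of prime divisors of $n$ counted with multiplicity. For real $x\ge 2$ let $L(x)$ be the supremum of all $r\ge 0$ such that for every finite Dirichlet polynomial $\sum_{n\le x} a_n n^{-s}$ (with complex coefficients $a_n$) one has \[ \sum_{n\le x}|a_n|\, r^{\Omega(n)} \le \sup_{\operatorname{Re} s>0}\Big|\sum_{n\le x} a_n n^{-s}\Big| \;\Big(=\sup_{t\in\mathbb{R}}\Big|\sum_{n\le x}a_n n^{-it}\Big|\Big). \] Then there are constants $c,C>0$ such that for all $x\ge 2$ \[ c\,\frac{(\log x)^{1/4}}{x^{1/8}} \le L(x)\le C\,\frac{(\log x)^{1/4}}{x^{1/8}}. \] In particular, there is a universal constant $C>0$ such that \[ \sum_{n\le x}|a_n|\left(\frac{C(\log n)^{1/4}}{n^{1/8}}\right)^{\Omega(n)}\le \sup_{\operatorname{Re}s>0}\Big|\sum_{n\le x}a_n n^{-s}\Big| \] for every $x\ge 2$ and every finite Dirichlet polynomial $\sum_{n\le x}a_n n^{-s}$.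
   Context: The paper writes $f(x)=O(g(x))$ to mean that both $f\ll g$ and $g\ll f$, i.e. $f$ and $g$ are comparable up to positive multiplicative constants; the main statement is $L(x)=O\big((\log x)^{1/4}x^{-1/8}\big)$ in this two-sided sense. In the displayed sum the term with $n=1$ has $\Omega(1)=0$, so its weight is $1$. *)

theory Defs
  imports "HOL-Analysis.Analysis" "HOL-Computational_Algebra.Primes" "HOL-Real_Asymp.Real_Asymp"
begin

definition Omega :: "nat \<Rightarrow> nat" where
  "Omega n = size (prime_factorization n)"

definition nats_upto :: "real \<Rightarrow> nat set" where
  "nats_upto x = {n. 1 \<le> n \<and> real n \<le> x}"

definition dirichlet_poly :: "real \<Rightarrow> (nat \<Rightarrow> complex) \<Rightarrow> complex \<Rightarrow> complex" where
  "dirichlet_poly x a s = (\<Sum>n\<in>nats_upto x. a n * of_nat n powr (- s))"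

definition dirichlet_sup :: "real \<Rightarrow> (nat \<Rightarrow> complex) \<Rightarrow> real" where
  "dirichlet_sup x a = (SUP s\<in>{s. Re s > 0}. norm (dirichlet_poly x a s))"

definition bohr_admissible :: "real \<Rightarrow> real set" where
  "bohr_admissible x =
     {r. 0 \<le> r \<and> (\<forall>a. (\<Sum>n\<in>nats_upto x. norm (a n) * r ^ Omega n) \<le> dirichlet_sup x a)}"

definition dirichlet_bohr_radius :: "real \<Rightarrow> real" where
  "dirichlet_bohr_radius x = Sup (bohr_admissible x)"

text \<open>A supremum of a real set is only meaningful if the set is nonempty and bounded above. The
  following lemmas establish this for all the suprema involved.\<close>

lemma finite_nats_upto: "finite (nats_upto x)"
proof (rule finite_subset)
  show "nats_upto x \<subseteq> {..nat \<lfloor>x\<rfloor>}"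
    by (auto simp: nats_upto_def le_nat_iff le_floor_iff)
qed simp

lemma norm_nat_powr_minus:
  "n \<ge> 1 \<Longrightarrow> norm (of_nat n powr (- s) :: complex) = real n powr (- Re s)"
  using norm_powr_real_powr[of "of_nat n" "- s"] by simp

lemma norm_dirichlet_poly_le:
  assumes "Re s \<ge> 0"
  shows "norm (dirichlet_poly x a s) \<le> (\<Sum>n\<in>nats_upto x. norm (a n))"
  unfolding dirichlet_poly_def
proof (rule sum_norm_le)
  fix n assume "n \<in> nats_upto x"
  hence n: "n \<ge> 1" by (simp add: nats_upto_def)
  have "real n powr (- Re s) \<le> 1"
    using n assms by (simp add: powr_minus field_simps ge_one_powr_ge_zero)
  thus "norm (a n * of_nat n powr (- s)) \<le> norm (a n)"
    using n by (simp add: norm_mult norm_nat_powr_minus mult_left_le)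
qed

lemma bdd_above_dirichlet_poly:
  assumes "S \<subseteq> {s. Re s \<ge> 0}"
  shows "bdd_above ((\<lambda>s. norm (dirichlet_poly x a s)) ` S)"
  by (rule bdd_aboveI2[OF norm_dirichlet_poly_le]) (use assms in auto)

lemma zero_in_bohr_admissible:
  assumes "x \<ge> 2"
  shows "0 \<in> bohr_admissible x"
proof -
  have 1: "1 \<in> nats_upto x" using assms by (simp add: nats_upto_def)
  have "norm (a 1) \<le> dirichlet_sup x a" for a
  proof (rule tendsto_upperbound)
    have "((\<lambda>t. \<Sum>n\<in>nats_upto x. a n * of_nat n powr (- of_real t))
             \<longlongrightarrow> (\<Sum>n\<in>nats_upto x. if n = 1 then a 1 else 0)) at_top"
    proof (rule tendsto_sum)
      fix n assume n: "n \<in> nats_upto x"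
      show "((\<lambda>t. a n * of_nat n powr (- of_real t)) \<longlongrightarrow> (if n = 1 then a 1 else 0)) at_top"
      proof (cases "n = 1")
        case False
        hence n2: "real n > 1" using n by (auto simp: nats_upto_def)
        have "((\<lambda>t. real n powr (- t)) \<longlongrightarrow> 0) at_top"
          using n2 by real_asymp
        moreover have "norm (of_nat n powr (- of_real t) :: complex) = real n powr (- t)" for t :: real
          using n2 by (simp add: norm_nat_powr_minus)
        ultimately have "((\<lambda>t::real. of_nat n powr (- of_real t) :: complex) \<longlongrightarrow> 0) at_top"
          by (subst tendsto_norm_zero_iff [symmetric]) simp
        from tendsto_mult_right_zero[OF this, of "a n"] show ?thesis
          using False by simp
      qed simp
    qed
    also have "(\<Sum>n\<in>nats_upto x. if n = 1 then a 1 else 0) = a 1"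
      using 1 by (simp add: finite_nats_upto)
    finally show "((\<lambda>t. norm (dirichlet_poly x a (of_real t))) \<longlongrightarrow> norm (a 1)) at_top"
      unfolding dirichlet_poly_def by (rule tendsto_norm)
    show "eventually (\<lambda>t. norm (dirichlet_poly x a (of_real t)) \<le> dirichlet_sup x a) at_top"
      using eventually_gt_at_top[of 0]
    proof eventually_elim
      case (elim t)
      thus ?case unfolding dirichlet_sup_def
        by (intro cSUP_upper bdd_above_dirichlet_poly) auto
    qed
  qed simp
  moreover have "(\<Sum>n\<in>nats_upto x. norm (a n) * 0 ^ Omega n) = norm (a 1)" for a :: "nat \<Rightarrow> complex"
  proof -
    have "(\<Sum>n\<in>nats_upto x. norm (a n) * 0 ^ Omega n) = (\<Sum>n\<in>nats_upto x. if n = 1 then norm (a 1) else 0)"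
      by (intro sum.cong) (auto simp: nats_upto_def Omega_def prime_factorization_empty_iff)
    thus ?thesis using 1 by (simp add: finite_nats_upto)
  qed
  ultimately show ?thesis by (simp add: bohr_admissible_def)
qed

lemma bohr_admissible_le_1:
  assumes "x \<ge> 2" "r \<in> bohr_admissible x"
  shows "r \<le> 1"
proof -
  define a :: "nat \<Rightarrow> complex" where "a = (\<lambda>n. if n = 2 then 1 else 0)"
  have 2: "2 \<in> nats_upto x" using assms by (simp add: nats_upto_def)
  have "(\<Sum>n\<in>nats_upto x. norm (a n) * r ^ Omega n) =
        (\<Sum>n\<in>nats_upto x. if n = 2 then r ^ Omega 2 else 0)"
    by (intro sum.cong) (auto simp: a_def)
  also have "\<dots> = r"
    using 2 by (simp add: finite_nats_upto Omega_def prime_factorization_prime)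
  finally have "r \<le> dirichlet_sup x a"
    using assms(2) unfolding bohr_admissible_def by (metis (mono_tags, lifting) mem_Collect_eq)
  also have "\<dots> \<le> (\<Sum>n\<in>nats_upto x. norm (a n))"
    unfolding dirichlet_sup_def
    by (rule cSUP_least) (auto intro!: norm_dirichlet_poly_le exI[of _ 1])
  also have "\<dots> = (\<Sum>n\<in>nats_upto x. if n = 2 then 1 else 0)"
    by (intro sum.cong) (auto simp: a_def)
  also have "\<dots> = 1"
    using 2 by (simp add: finite_nats_upto)
  finally show ?thesis .
qed

end

theory Submission
  imports Defs "HOL-Complex_Analysis.Conformal_Mappings"
begin

text \<open>
  By Kronecker's theorem a Dirichlet polynomial is a polynomial on the polytorus, one variable per
  prime. Caratheodory's inequality bounds its part of degree $m \ge 1$ by $2(B - |a_1|)$, where $B$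
  is the sup norm, so it suffices to show
  $\sum_{\Omega(n) = m} |a_n| g(n)^m \le K^m B$ with $g(n) = (\log n)^{1/4} n^{-1/8}$ for
  $m$-homogeneous polynomials of norm $B$. For $m \ge 5$ this is the Cauchy-Schwarz inequality. For
  $m \le 4$ bounding the gradient on the torus and comparing its $L^1$ and $L^2$ norms gives the
  mixed inequality $\sum_q (\sum_{q | n} |a_n|^2)^{1/2} \le C B$, and the Cauchy-Schwarz inequality is
  applied for each largest prime factor $q$ separately. The critical degree is $m = 2$, where
  Chebyshev's upper estimate is needed; there the form of the discrete Fourier matrix in the
  primes up to $\sqrt x$, together with Chebyshev's lower estimate, shows that the bound is sharp.
\<close>

text \<open>Cauchy-Schwarz against the L^2 norm of the coefficients needs the sum of g(n)^(2m) =
  (log n)^(m/2) n^(-m/4) to converge, which fails for m \<le> 4. The mixed inequality repairs this: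
  with the largest prime factor q fixed, n = q k with k \<le> q^(m-1), so decay in q becomes decay
  in k, and for m \<ge> 2 the exponent improves from m/4 to m^2/(4(m-1)). This is above 1 for m = 3
  and m = 4 and equals 1 for m = 2. There the quantity to be bounded is about (log q) q^(-1/2) times
  the sum of p^(-1/2) over the primes p \<le> q, and the density 1/log q of the primes just cancels
  log q: this balance is the origin of the power (log n)^(1/4).

  Constants K^m are harmless because the radius enters to the power \<Omega>(n): with radius g/(3K)
  the degree m contributes at most 3^(-m) 2(B - |a_1|), and these sum to at most B - |a_1|.

  Means over the infinite torus are finite averages over points chosen so that the characters
  involved are orthogonal; no integration occurs.\<close>

lemma sum_norm_le_if_subset_sums_le:
  fixes c :: "'a \<Rightarrow> complex"
  assumes "finite Q" and bound: "\<And>S. S \<subseteq> Q \<Longrightarrow> norm (sum c S) \<le> B"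
  shows "(\<Sum>q\<in>Q. norm (c q)) \<le> 4 * B"
proof -
  \<comment> \<open>Splitting a real family by sign costs a factor 2; passing to real and imaginary
    parts costs another 2, whence the 4.\<close>
  have half: "(\<Sum>q\<in>Q. \<bar>f q\<bar>) \<le> 2 * B" if "\<And>S. S \<subseteq> Q \<Longrightarrow> \<bar>sum f S\<bar> \<le> B"
    for f :: "'a \<Rightarrow> real"
  proof -
    have "(\<Sum>q\<in>Q. \<bar>f q\<bar>) = (\<Sum>q\<in>{q\<in>Q. f q \<ge> 0}. \<bar>f q\<bar>) + (\<Sum>q\<in>{q\<in>Q. \<not> f q \<ge> 0}. \<bar>f q\<bar>)"
      using assms(1) by (subst sum.union_disjoint[symmetric]) (auto intro!: sum.cong)
    also have "(\<Sum>q\<in>{q\<in>Q. f q \<ge> 0}. \<bar>f q\<bar>) = sum f {q\<in>Q. f q \<ge> 0}"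
      by (intro sum.cong) auto
    also have "(\<Sum>q\<in>{q\<in>Q. \<not> f q \<ge> 0}. \<bar>f q\<bar>) = - sum f {q\<in>Q. \<not> f q \<ge> 0}"
      by (subst sum_negf[symmetric], intro sum.cong) auto
    also have "sum f {q\<in>Q. f q \<ge> 0} + - sum f {q\<in>Q. \<not> f q \<ge> 0} \<le> 2 * B"
      using that[of "{q\<in>Q. f q \<ge> 0}"] that[of "{q\<in>Q. \<not> f q \<ge> 0}"] by auto
    finally show ?thesis .
  qed
  have "(\<Sum>q\<in>Q. norm (c q)) \<le> (\<Sum>q\<in>Q. \<bar>Re (c q)\<bar> + \<bar>Im (c q)\<bar>)"
    by (intro sum_mono cmod_le)
  also have "\<dots> = (\<Sum>q\<in>Q. \<bar>Re (c q)\<bar>) + (\<Sum>q\<in>Q. \<bar>Im (c q)\<bar>)"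
    by (rule sum.distrib)
  also have "(\<Sum>q\<in>Q. \<bar>Re (c q)\<bar>) \<le> 2 * B"
    by (rule half) (metis Re_sum abs_Re_le_cmod bound order_trans)
  also have "(\<Sum>q\<in>Q. \<bar>Im (c q)\<bar>) \<le> 2 * B"
    by (rule half) (metis Im_sum abs_Im_le_cmod bound order_trans)
  finally show ?thesis by simp
qed

lemma norm_sum_sq_le_card:
  fixes f :: "'a \<Rightarrow> complex"
  shows "(norm (sum f A))\<^sup>2 \<le> real (card A) * (\<Sum>x\<in>A. (norm (f x))\<^sup>2)"
proof -
  have "(norm (sum f A))\<^sup>2 \<le> (\<Sum>x\<in>A. norm (f x))\<^sup>2"
    by (intro power_mono norm_sum) auto
  also have "\<dots> \<le> (\<Sum>x\<in>A. (norm (f x))\<^sup>2) * real (card A)"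
    by (rule sum_squared_le_sum_of_squares)
  finally show ?thesis by (simp add: mult.commute)
qed

section \<open>Averaging over roots of unity\<close>

definition root_of_unity :: "nat \<Rightarrow> nat \<Rightarrow> complex" where
  "root_of_unity M j = cis (2 * pi * real j / real M)"

lemma norm_root_of_unity [simp]: "norm (root_of_unity M j) = 1"
  by (simp add: root_of_unity_def)

lemma root_of_unity_power: "root_of_unity M j ^ k = root_of_unity M (j * k)"
  by (simp add: root_of_unity_def Complex.DeMoivre field_simps)

lemma sum_root_of_unity_diff:
  assumes "a < M" "b < M"
  shows "(\<Sum>j<M. root_of_unity M j ^ a * cnj (root_of_unity M j ^ b)) = (if a = b then of_nat M else 0)"
proof (cases "a = b")
  case True
  have "root_of_unity M j ^ a * cnj (root_of_unity M j ^ a) = 1" for j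
    by (simp only: complex_norm_square[symmetric] norm_power norm_root_of_unity) simp
  thus ?thesis using True by simp
next
  case False
  define t where "t = 2 * pi * (real a - real b) / real M"
  have M: "M > 0" using assms by simp
  have *: "root_of_unity M j ^ a * cnj (root_of_unity M j ^ b) = cis t ^ j" for j
    unfolding root_of_unity_def Complex.DeMoivre cis_cnj cis_mult t_def
    using M by (intro arg_cong[of _ _ cis]) (simp add: field_simps)
  have "cis t \<noteq> 1"
  proof
    assume "cis t = 1"
    hence "cos t = 1" by (metis cis.sel(1) one_complex.sel(1))
    then obtain k :: int where k: "t = k * 2 * pi" using cos_one_2pi_int by auto
    hence "2 * pi * real_of_int (int a - int b) = 2 * pi * real_of_int (k * int M)"
      using M by (simp add: t_def field_simps)
    hence "real_of_int (int a - int b) = real_of_int (k * int M)"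
      using pi_gt_zero by (subst (asm) mult_cancel_left) simp
    hence "int a - int b = k * int M" by (simp only: of_int_eq_iff)
    hence "int M dvd int a - int b" by simp
    moreover have "\<bar>int a - int b\<bar> < int M" using assms by auto
    ultimately show False using False zdvd_imp_le[of "int M" "\<bar>int a - int b\<bar>"] by auto
  qed
  moreover have "cis t ^ M = 1"
  proof -
    have "real M * t = 2 * pi * of_int (int a - int b)" using M by (simp add: t_def)
    thus ?thesis by (simp only: Complex.DeMoivre cis_multiple_2pi Ints_of_int)
  qed
  ultimately show ?thesis using False by (simp only: *) (simp add: sum_gp_strict)
qed

lemma sum_root_of_unity_eq_0:
  assumes "0 < a" "a < M"
  shows "(\<Sum>j<M. root_of_unity M j ^ a) = 0"
  using sum_root_of_unity_diff[of a M 0] assms by simp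

text \<open>Cauchy's coefficient formula with the circle integral replaced by an average over the
  \<open>M\<close>-th roots of unity, which is exact because all exponents are below
  \<open>M\<close>.\<close>

lemma root_of_unity_coeff:
  fixes c :: "'a \<Rightarrow> complex" and f :: "'a \<Rightarrow> nat"
  assumes "finite A" "k < M" "\<And>n. n \<in> A \<Longrightarrow> f n < M"
  shows "(\<Sum>j<M. (\<Sum>n\<in>A. c n * root_of_unity M j ^ f n) * cnj (root_of_unity M j ^ k))
           = of_nat M * (\<Sum>n | n \<in> A \<and> f n = k. c n)"
proof -
  have "(\<Sum>j<M. (\<Sum>n\<in>A. c n * root_of_unity M j ^ f n) * cnj (root_of_unity M j ^ k))
      = (\<Sum>n\<in>A. c n * (\<Sum>j<M. root_of_unity M j ^ f n * cnj (root_of_unity M j ^ k)))"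
    by (simp add: sum_distrib_left sum_distrib_right mult_ac sum.swap[of _ A])
  also have "\<dots> = (\<Sum>n\<in>A. if f n = k then of_nat M * c n else 0)"
    using assms by (intro sum.cong refl, subst sum_root_of_unity_diff) auto
  also have "\<dots> = of_nat M * (\<Sum>n | n \<in> A \<and> f n = k. c n)"
    using assms(1) by (simp add: sum.If_cases sum_distrib_left Int_def)
  finally show ?thesis .
qed

text \<open>The slack \<open>k\<close> is for exponents \<open>f n + k\<close>, which must not wrap
  around modulo \<open>M\<close>; \<open>M > k\<close> is listed separately because \<open>A\<close>
  may be empty.\<close>

lemma ex_exponent_bound:
  fixes f :: "'a \<Rightarrow> nat"
  assumes "finite A"
  obtains M where "M > k" "\<And>n. n \<in> A \<Longrightarrow> f n + k < M"
proof -
  have "f n + k < Suc (k + Max (insert 0 (f ` A)))" if "n \<in> A" for n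
    using that assms by (simp add: le_imp_less_Suc add.commute)
  thus ?thesis by (intro that[of "Suc (k + Max (insert 0 (f ` A)))"]) auto
qed

lemma norm_coeff_le:
  fixes c :: "'a \<Rightarrow> complex" and f :: "'a \<Rightarrow> nat"
  assumes "finite A"
    and bound: "\<And>u. norm u = 1 \<Longrightarrow> norm (\<Sum>n\<in>A. c n * u ^ f n) \<le> B"
  shows "norm (\<Sum>n | n \<in> A \<and> f n = k. c n) \<le> B"
proof -
  obtain M where M: "M > k" "\<And>n. n \<in> A \<Longrightarrow> f n + k < M"
    using ex_exponent_bound[OF assms(1)] by blast
  have "real M * norm (\<Sum>n | n \<in> A \<and> f n = k. c n)
      = norm (\<Sum>j<M. (\<Sum>n\<in>A. c n * root_of_unity M j ^ f n) * cnj (root_of_unity M j ^ k))"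
    using M(2) by (subst root_of_unity_coeff[OF assms(1) M(1)]) (force simp: norm_mult)+
  also have "\<dots> \<le> (\<Sum>j<M. B)"
    by (intro sum_norm_le) (simp add: norm_mult norm_power bound)
  finally show ?thesis using M(1) by simp
qed

text \<open>The bound is Caratheodory's inequality for $B - uP$, which has nonnegative real part.\<close>

lemma norm_coeff_le_Caratheodory:
  fixes c :: "'a \<Rightarrow> complex" and f :: "'a \<Rightarrow> nat"
  assumes "finite A" "k > 0"
    and bound: "\<And>u. norm u = 1 \<Longrightarrow> norm (\<Sum>n\<in>A. c n * u ^ f n) \<le> B"
  shows "norm (\<Sum>n | n \<in> A \<and> f n = k. c n) \<le> 2 * (B - norm (\<Sum>n | n \<in> A \<and> f n = 0. c n))"
proof -
  obtain M where M: "M > k" "\<And>n. n \<in> A \<Longrightarrow> f n + k < M"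
    using ex_exponent_bound[OF assms(1)] by blast
  define c0 where "c0 = (\<Sum>n | n \<in> A \<and> f n = 0. c n)"
  define ck where "ck = (\<Sum>n | n \<in> A \<and> f n = k. c n)"
  \<comment> \<open>A rotation that makes the constant coefficient real and nonnegative, so that
    averaging the real part of \<open>P\<close> yields its full modulus.\<close>
  define v where "v = (if c0 = 0 then 1 else cnj (sgn c0))"
  have v: "norm v = 1" by (simp add: v_def norm_sgn)
  have v0: "v * c0 = of_real (norm c0)"
    by (auto simp: v_def sgn_eq field_simps complex_norm_square[symmetric] power2_eq_square)
  define P where "P = (\<lambda>j. v * (\<Sum>n\<in>A. c n * root_of_unity M j ^ f n))"
  define w where "w = (\<lambda>j. cnj (root_of_unity M j ^ k))"
  have w: "norm (w j) = 1" for j by (simp add: w_def norm_power)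
  have Pw: "(\<Sum>j<M. P j * w j) = of_nat M * (v * ck)"
  proof -
    have "(\<Sum>j<M. P j * w j)
        = v * (\<Sum>j<M. (\<Sum>n\<in>A. c n * root_of_unity M j ^ f n) * cnj (root_of_unity M j ^ k))"
      by (simp add: P_def w_def sum_distrib_left mult_ac)
    thus ?thesis using M by (subst (asm) root_of_unity_coeff) (force simp: ck_def assms(1))+
  qed
  have P0: "(\<Sum>j<M. P j) = of_nat M * of_real (norm c0)"
  proof -
    have "(\<Sum>j<M. P j)
        = v * (\<Sum>j<M. (\<Sum>n\<in>A. c n * root_of_unity M j ^ f n) * cnj (root_of_unity M j ^ 0))"
      by (simp add: P_def sum_distrib_left mult_ac)
    also have "\<dots> = of_nat M * (v * c0)"
      using M by (subst root_of_unity_coeff) (force simp: c0_def assms(1))+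
    finally show ?thesis by (simp add: v0)
  qed
  have cw: "(\<Sum>j<M. w j) = 0"
    using sum_root_of_unity_eq_0[OF assms(2) M(1)]
    by (metis (no_types, lifting) complex_cnj_zero cnj_sum sum.cong w_def)
  \<comment> \<open>Conjugation leaves only the frequencies \<open>- (f n + k)\<close>, strictly
    between \<open>- M\<close> and 0, so nothing aliases onto frequency 0.\<close>
  have Pcw: "(\<Sum>j<M. cnj (P j) * w j) = 0"
  proof -
    have "(\<Sum>j<M. P j * root_of_unity M j ^ k)
        = v * (\<Sum>n\<in>A. c n * (\<Sum>j<M. root_of_unity M j ^ (f n + k)))"
      by (simp add: P_def power_add sum_distrib_left sum_distrib_right mult_ac sum.swap[of _ A])
    also have "\<dots> = 0"
      using M assms(2) by (subst sum.neutral) (auto simp: sum_root_of_unity_eq_0)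
    finally have "cnj (\<Sum>j<M. P j * root_of_unity M j ^ k) = 0" by simp
    thus ?thesis by (simp add: w_def)
  qed
  \<comment> \<open>2 (B - Re P) = 2 B - P - cnj P, and only the term P has a frequency matching
    \<open>w\<close>. As 2 (B - Re P) is nonnegative, its modulus can be averaged without
    loss.\<close>
  have "(\<Sum>j<M. of_real (2 * (B - Re (P j))) * w j)
      = (\<Sum>j<M. 2 * of_real B * w j - P j * w j - cnj (P j) * w j)"
    by (intro sum.cong refl) (simp add: complex_eq_iff algebra_simps)
  also have "\<dots> = - of_nat M * (v * ck)"
    by (simp only: sum_subtractf Pw Pcw sum_distrib_left[symmetric] cw) simp
  finally have "real M * norm ck = norm (\<Sum>j<M. of_real (2 * (B - Re (P j))) * w j)"
    by (simp add: norm_mult v)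
  also have "\<dots> \<le> (\<Sum>j<M. 2 * (B - Re (P j)))"
  proof (rule sum_norm_le)
    fix j
    have "norm (P j) \<le> B" using bound[of "root_of_unity M j"] by (simp add: P_def norm_mult v)
    hence "Re (P j) \<le> B" using complex_Re_le_cmod order_trans by blast
    thus "norm (of_real (2 * (B - Re (P j))) * w j) \<le> 2 * (B - Re (P j))"
      by (simp only: norm_mult w norm_of_real) simp
  qed
  also have "\<dots> = 2 * (real M * B - Re (\<Sum>j<M. P j))"
    by (simp add: sum_subtractf sum_distrib_left[symmetric])
  also have "\<dots> = real M * (2 * (B - norm c0))"
    by (simp add: P0 algebra_simps)
  finally show ?thesis using M(1) by (simp add: ck_def c0_def)
qed

section \<open>Completely multiplicative extensions\<close>

text \<open>A point \<open>z\<close> of the polytorus turned into a completely multiplicative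
  function; replacing n^(-s) by \<open>chi z n\<close> is the Bohr lift. The factorization of 0 is
  empty, so \<open>chi z 0 = 1\<close> and multiplicativity holds for positive arguments
  only.\<close>

definition chi :: "(nat \<Rightarrow> complex) \<Rightarrow> nat \<Rightarrow> complex" where
  "chi z n = prod_mset (image_mset z (prime_factorization n))"

lemma chi_1 [simp]: "chi z (Suc 0) = 1"
  by (simp add: chi_def)

lemma chi_mult: "m > 0 \<Longrightarrow> n > 0 \<Longrightarrow> chi z (m * n) = chi z m * chi z n"
  by (simp add: chi_def prime_factorization_mult)

lemma chi_prime: "prime p \<Longrightarrow> chi z p = z p"
  by (simp add: chi_def prime_factorization_prime)

lemma chi_cong: "(\<And>p. p \<in> prime_factors n \<Longrightarrow> z p = z' p) \<Longrightarrow> chi z n = chi z' n"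
  unfolding chi_def by (metis image_mset_cong)

lemma chi_times: "chi (\<lambda>p. z p * z' p) n = chi z n * chi z' n"
  by (simp add: chi_def prod_mset.distrib)

lemma chi_const: "chi (\<lambda>_. u) n = u ^ Omega n"
  by (simp add: chi_def Omega_def)

lemma chi_conv_prod: "chi z n = (\<Prod>p\<in>prime_factors n. z p ^ multiplicity p n)"
  unfolding chi_def image_prod_mset_multiplicity
  by (intro prod.cong) (auto simp: count_prime_factorization in_prime_factors_iff)

lemma Omega_mult: "m > 0 \<Longrightarrow> n > 0 \<Longrightarrow> Omega (m * n) = Omega m + Omega n"
  by (simp add: Omega_def prime_factorization_mult)

text \<open>Turns a polynomial on the torus into a one-variable polynomial in \<open>u\<close>,
  graded by the degree in the variables of \<open>S\<close>. General \<open>S\<close> serve the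
  gradient bound, singletons the maximum modulus principle.\<close>

lemma chi_rotate:
  assumes "n > 0" "finite S" "\<And>p. p \<in> S \<Longrightarrow> prime p"
  shows "chi (\<lambda>p. if p \<in> S then u * z p else z p) n = u ^ (\<Sum>q\<in>S. multiplicity q n) * chi z n"
proof -
  have "chi (\<lambda>p. if p \<in> S then u * z p else z p) n = chi (\<lambda>p. if p \<in> S then u else 1) n * chi z n"
    by (subst chi_times[symmetric]) (auto intro!: chi_cong)
  also have "chi (\<lambda>p. if p \<in> S then u else 1) n
      = (\<Prod>p\<in>prime_factors n. if p \<in> S then u ^ multiplicity p n else 1)"
    unfolding chi_conv_prod by (intro prod.cong) auto
  also have "\<dots> = (\<Prod>p\<in>S \<inter> prime_factors n. u ^ multiplicity p n)"
    by (simp add: prod.If_cases Int_commute)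
  also have "\<dots> = (\<Prod>p\<in>S. u ^ multiplicity p n)"
    using assms by (intro prod.mono_neutral_left)
      (auto simp: prime_factors_dvd not_dvd_imp_multiplicity_0)
  also have "\<dots> = u ^ (\<Sum>q\<in>S. multiplicity q n)"
    by (simp add: power_sum)
  finally show ?thesis .
qed

lemma sum_multiplicity_le_Omega:
  assumes "n > 0" "finite S" "\<And>p. p \<in> S \<Longrightarrow> prime p"
  shows "(\<Sum>q\<in>S. multiplicity q n) \<le> Omega n"
proof -
  have "(\<Sum>q\<in>S. multiplicity q n) = (\<Sum>q\<in>S \<inter> prime_factors n. multiplicity q n)"
    using assms by (intro sum.mono_neutral_right)
      (auto simp: prime_factors_dvd not_dvd_imp_multiplicity_0)
  also have "\<dots> \<le> (\<Sum>q\<in>prime_factors n. multiplicity q n)"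
    by (intro sum_mono2) auto
  also have "\<dots> = Omega n"
    unfolding Omega_def size_multiset_overloaded_eq
    by (intro sum.cong) (auto simp: count_prime_factorization in_prime_factors_iff)
  finally show ?thesis .
qed

section \<open>Sampling on the polytorus\<close>

lemma prime_factorization_sum_ln:
  assumes "n > 0"
  shows "(\<Sum>p\<in>#prime_factorization n. ln (real p)) = ln (real n)"
proof -
  have "(\<And>p. p \<in># A \<Longrightarrow> p > 0) \<Longrightarrow> (\<Sum>p\<in>#A. ln (real p)) = ln (real (prod_mset A)) \<and> prod_mset A > 0"
    for A :: "nat multiset"
    by (induction A) (auto simp: ln_mult)
  from this[of "prime_factorization n"] show ?thesis
    using assms by (auto simp: prime_factors_gt_0_nat prod_mset_prime_factorization_nat)
qed

lemma two_power_Omega_le: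
  assumes "n > 0"
  shows "2 ^ Omega n \<le> n"
proof -
  have "(\<And>p. p \<in># A \<Longrightarrow> p \<ge> 2) \<Longrightarrow> 2 ^ size A \<le> prod_mset A" for A :: "nat multiset"
    by (induction A) (auto intro!: mult_mono)
  from this[of "prime_factorization n"] show ?thesis
    using assms by (auto simp: Omega_def in_prime_factors_iff prime_ge_2_nat prod_mset_prime_factorization_nat)
qed

text \<open>Rounding $W \log p$ to an integer for each prime $p$ gives a completely additive function
  that stays within $\Omega(n)$ of $W \log n$, so it is injective on $\{1,\dots,N\}$ once $W$ is
  large. This turns the torus of all primes up to $N$ into a single cyclic group.\<close>

lemma ex_torus_sample:
  obtains M :: nat and z :: "nat \<Rightarrow> nat \<Rightarrow> complex"
  where "M > 0" "\<And>j p. norm (z j p) = 1"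
    "\<And>n k. n \<in> {1..N} \<Longrightarrow> k \<in> {1..N} \<Longrightarrow>
       (\<Sum>j<M. chi (z j) n * cnj (chi (z j) k)) = (if n = k then of_nat M else 0)"
proof -
  \<comment> \<open>Logarithms of distinct integers up to \<open>N\<close> differ by at least 1/N,
    and rounding costs at most \<open>N\<close>; since W/N > 2N, the order survives.\<close>
  define W where "W = 2 * real N ^ 2 + 1"
  define f where "f = (\<lambda>p::nat. nat \<lfloor>W * ln (real p)\<rfloor>)"
  define h where "h = (\<lambda>n. \<Sum>p\<in>#prime_factorization n. f p)"
  have W: "W \<ge> 0" by (simp add: W_def)
  have f: "real (f p) \<le> W * ln (real p) \<and> W * ln (real p) \<le> real (f p) + 1" if "p > 0" for p
  proof -
    have "W * ln (real p) \<ge> 0" using W that by auto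
    thus ?thesis unfolding f_def by linarith
  qed
  have aux: "(\<And>p. p \<in># A \<Longrightarrow> p > 0) \<Longrightarrow>
      real (\<Sum>p\<in>#A. f p) \<le> W * (\<Sum>p\<in>#A. ln (real p)) \<and>
      W * (\<Sum>p\<in>#A. ln (real p)) \<le> real (\<Sum>p\<in>#A. f p) + real (size A)" for A
  proof (induction A)
    case (add p A)
    have "real (f p) \<le> W * ln (real p) \<and> W * ln (real p) \<le> real (f p) + 1"
      using f[of p] add.prems by simp
    moreover have "real (\<Sum>p\<in>#A. f p) \<le> W * (\<Sum>p\<in>#A. ln (real p)) \<and>
      W * (\<Sum>p\<in>#A. ln (real p)) \<le> real (\<Sum>p\<in>#A. f p) + real (size A)"
      using add by auto
    ultimately show ?case by (simp add: distrib_left)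
  qed simp
  have h: "real (h n) \<le> W * ln (real n)" "W * ln (real n) \<le> real (h n) + real N"
    if "n \<in> {1..N}" for n
  proof -
    have "Omega n < 2 ^ Omega n" by (rule less_exp)
    also have "\<dots> \<le> n" using two_power_Omega_le[of n] that by simp
    finally have "Omega n \<le> N" using that by simp
    thus "real (h n) \<le> W * ln (real n)" "W * ln (real n) \<le> real (h n) + real N"
      using aux[of "prime_factorization n"] prime_factorization_sum_ln[of n] that
      by (auto simp: h_def Omega_def prime_factors_gt_0_nat)
  qed
  have mono: "h n < h k" if "n \<in> {1..N}" "k \<in> {1..N}" "n < k" for n k
  proof -
    have "ln (real n / real k) \<le> real n / real k - 1"
      using that by (intro ln_le_minus_one) auto
    also have "\<dots> = (real n - real k) / real k" using that by (simp add: field_simps)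
    also have "\<dots> \<le> - 1 / real k" using that by (intro divide_right_mono) auto
    also have "\<dots> \<le> - 1 / real N" using that by (simp add: field_simps)
    finally have "ln (real n) + 1 / real N \<le> ln (real k)"
      using that by (simp add: ln_div)
    hence "W * (ln (real n) + 1 / real N) \<le> W * ln (real k)" using W by (rule mult_left_mono)
    moreover have "W * (1 / real N) > 2 * real N"
      using that by (simp add: W_def field_simps power2_eq_square)
    ultimately have "W * ln (real n) + 2 * real N < W * ln (real k)"
      by (simp add: distrib_left)
    with h(1)[of n] h(2)[of k] that have "real (h n) < real (h k)"
      using h(2)[of n] h(1)[of k] by (smt (verit) of_nat_0_le_iff)
    thus ?thesis by simp
  qed
  have inj: "h n = h k \<longleftrightarrow> n = k" if "n \<in> {1..N}" "k \<in> {1..N}" for n k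
    using mono[of n k] mono[of k n] that by (metis less_irrefl nat_neq_iff)
  define M where "M = Suc (Max (insert 0 (h ` {1..N})))"
  have M: "h n < M" if "n \<in> {1..N}" for n
    using that by (auto simp: M_def less_Suc_eq_le)
  define z where "z = (\<lambda>j p. root_of_unity M j ^ f p)"
  have "chi (z j) n = root_of_unity M j ^ h n" for j n
  proof -
    have "prod_mset (image_mset (\<lambda>p. u ^ f p) A) = u ^ (\<Sum>p\<in>#A. f p)" for u :: complex and A
      by (induction A) (auto simp: power_add)
    thus ?thesis by (simp add: chi_def z_def h_def)
  qed
  hence "(\<Sum>j<M. chi (z j) n * cnj (chi (z j) k)) = (if n = k then of_nat M else 0)"
    if "n \<in> {1..N}" "k \<in> {1..N}" for n k
    using sum_root_of_unity_diff[OF M M, of n k] that inj[of n k] by simp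
  thus ?thesis
    by (intro that[of M z]) (auto simp: M_def z_def norm_power)
qed

text \<open>The \<open>M\<close> points stand in for Haar measure: their average is exact on
  products of one character and one conjugate character with indices up to \<open>N\<close>, which
  is what Parseval's identity for polynomials of this length requires.\<close>

definition torus_sample :: "nat \<Rightarrow> nat \<Rightarrow> (nat \<Rightarrow> nat \<Rightarrow> complex) \<Rightarrow> bool" where
  "torus_sample N M z \<longleftrightarrow> M > 0 \<and> (\<forall>j p. norm (z j p) = 1) \<and>
     (\<forall>n\<in>{1..N}. \<forall>k\<in>{1..N}.
        (\<Sum>j<M. chi (z j) n * cnj (chi (z j) k)) = (if n = k then of_nat M else 0))"

lemma torus_sample_exists: "\<exists>M z. torus_sample N M z"
  using ex_torus_sample[of N] unfolding torus_sample_def by metis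

lemma torus_sample_Parseval:
  assumes "torus_sample N M z" "A \<subseteq> {1..N}"
  shows "(\<Sum>j<M. (norm (\<Sum>n\<in>A. b n * chi (z j) n))\<^sup>2) = real M * (\<Sum>n\<in>A. (norm (b n))\<^sup>2)"
proof -
  have A: "finite A" using assms(2) finite_subset by blast
  have "complex_of_real (\<Sum>j<M. (norm (\<Sum>n\<in>A. b n * chi (z j) n))\<^sup>2)
      = (\<Sum>j<M. \<Sum>n\<in>A. \<Sum>k\<in>A. b n * cnj (b k) * (chi (z j) n * cnj (chi (z j) k)))"
    by (simp add: complex_norm_square sum_product mult_ac del: of_real_power)
  also have "\<dots> = (\<Sum>n\<in>A. \<Sum>k\<in>A. b n * cnj (b k) * (\<Sum>j<M. chi (z j) n * cnj (chi (z j) k)))"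
    unfolding sum_distrib_left
    by (subst sum.swap[of _ A "{..<M}"], rule sum.cong[OF refl], rule sum.swap)
  also have "\<dots> = (\<Sum>n\<in>A. \<Sum>k\<in>A. if n = k then b n * cnj (b k) * of_nat M else 0)"
    using assms by (intro sum.cong refl) (auto simp: torus_sample_def subset_iff)
  also have "\<dots> = complex_of_real (real M * (\<Sum>n\<in>A. (norm (b n))\<^sup>2))"
    using A by (simp add: complex_norm_square sum_distrib_left mult_ac del: of_real_power)
  finally show ?thesis by (simp only: of_real_eq_iff)
qed

section \<open>Comparison of moments on the polytorus\<close>

text \<open>Each further prime factor \<open>p\<close> at most doubles the set of divisors: a
  divisor of \<open>p * n\<close> divides \<open>n\<close> or is \<open>p\<close> times a divisor of
  \<open>n\<close>.\<close>

lemma card_divisors_le_two_power_Omega: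
  assumes "n > 0"
  shows "card {d. d dvd n} \<le> 2 ^ Omega n"
  using assms
proof (induction n rule: prime_divisors_induct)
  case (factor p n)
  hence n: "n > 0" by auto
  have p: "p > 0" "prime p" using factor by (auto simp: prime_gt_0_nat)
  have "{d. d dvd p * n} \<subseteq> {d. d dvd n} \<union> (\<lambda>d. p * d) ` {d. d dvd n}"
  proof
    fix d assume "d \<in> {d. d dvd p * n}"
    hence d: "d dvd p * n" by simp
    show "d \<in> {d. d dvd n} \<union> (\<lambda>d. p * d) ` {d. d dvd n}"
    proof (cases "p dvd d")
      case True
      thus ?thesis using d p by (auto elim!: dvdE)
    next
      case False
      hence "coprime d p" using p prime_imp_coprime[of p d] by (simp add: coprime_commute)
      thus ?thesis using d by (simp add: coprime_dvd_mult_right_iff)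
    qed
  qed
  hence "card {d. d dvd p * n} \<le> card ({d. d dvd n} \<union> (\<lambda>d. p * d) ` {d. d dvd n})"
    using n by (intro card_mono) auto
  also have "\<dots> \<le> card {d. d dvd n} + card ((\<lambda>d. p * d) ` {d. d dvd n})"
    by (rule card_Un_le)
  also have "\<dots> \<le> card {d. d dvd n} + card {d. d dvd n}"
    using n by (intro add_left_mono card_image_le) auto
  also have "\<dots> \<le> 2 ^ Omega (p * n)"
    using factor.IH[OF n] p n by (simp add: Omega_mult) (simp add: Omega_def prime_factorization_prime)
  finally show ?case .
qed (auto simp: Omega_def)

text \<open>Parseval's identity is applied to the square of the polynomial. Its coefficient at
  \<open>n\<close> collects at most as many products as \<open>n\<close> has divisors, so
  Cauchy-Schwarz costs a factor \<open>4 ^ m\<close>. The products reach N^2, which explains the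
  range of the sample.\<close>

lemma fourth_moment_le:
  assumes sample: "torus_sample (N\<^sup>2) M z" and A: "A \<subseteq> {1..N}"
    and deg: "\<And>n. n \<in> A \<Longrightarrow> Omega n \<le> m"
  shows "(\<Sum>j<M. (norm (\<Sum>n\<in>A. b n * chi (z j) n)) ^ 4)
           \<le> real M * 4 ^ m * (\<Sum>n\<in>A. (norm (b n))\<^sup>2)\<^sup>2"
proof -
  have fA: "finite A" using A finite_subset by blast
  define F where "F = (\<lambda>n. {ab \<in> A \<times> A. fst ab * snd ab = n})"
  define g where "g = (\<lambda>ab. b (fst ab) * b (snd ab))"
  define c where "c = (\<lambda>n. sum g (F n))"
  have range: "fst ab * snd ab \<in> {1..N\<^sup>2}" if "ab \<in> A \<times> A" for ab
    using that A by (auto simp: power2_eq_square subset_iff intro!: mult_le_mono)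
  have sq: "(\<Sum>n\<in>A. b n * chi (z j) n)\<^sup>2 = (\<Sum>n\<in>{1..N\<^sup>2}. c n * chi (z j) n)" for j
  proof -
    have "(\<Sum>n\<in>A. b n * chi (z j) n)\<^sup>2
        = (\<Sum>ab\<in>A \<times> A. (b (fst ab) * chi (z j) (fst ab)) * (b (snd ab) * chi (z j) (snd ab)))"
      by (simp add: power2_eq_square sum_product sum.cartesian_product case_prod_unfold)
    also have "\<dots> = (\<Sum>ab\<in>A \<times> A. g ab * chi (z j) (fst ab * snd ab))"
    proof (intro sum.cong refl)
      fix ab assume "ab \<in> A \<times> A"
      hence "fst ab > 0" "snd ab > 0" using A by force+
      thus "(b (fst ab) * chi (z j) (fst ab)) * (b (snd ab) * chi (z j) (snd ab))
          = g ab * chi (z j) (fst ab * snd ab)"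
        by (simp add: g_def chi_mult)
    qed
    also have "\<dots> = (\<Sum>n\<in>{1..N\<^sup>2}. \<Sum>ab\<in>F n. g ab * chi (z j) (fst ab * snd ab))"
      unfolding F_def using fA range by (intro sum.group[symmetric]) auto
    also have "\<dots> = (\<Sum>n\<in>{1..N\<^sup>2}. c n * chi (z j) n)"
      by (intro sum.cong refl) (auto simp: c_def F_def sum_distrib_right intro!: sum.cong)
    finally show ?thesis .
  qed
  have c: "(norm (c n))\<^sup>2 \<le> 4 ^ m * (\<Sum>ab\<in>F n. (norm (g ab))\<^sup>2)" for n
  proof (cases "F n = {}")
    case False
    then obtain a1 a2 where a: "a1 \<in> A" "a2 \<in> A" "n = a1 * a2" by (auto simp: F_def)
    hence pos: "a1 > 0" "a2 > 0" using A by auto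
    have n: "n > 0" using a pos by simp
    have "card (F n) \<le> card {d. d dvd n}"
    proof (rule card_inj_on_le)
      show "inj_on fst (F n)" using n by (auto simp: inj_on_def F_def)
    qed (use n in \<open>auto simp: F_def\<close>)
    also have "\<dots> \<le> 2 ^ Omega n" by (rule card_divisors_le_two_power_Omega[OF n])
    also have "\<dots> \<le> 2 ^ (m + m)"
      using deg[of a1] deg[of a2] a pos by (intro power_increasing) (auto simp: Omega_mult)
    also have "\<dots> = 4 ^ m" by (simp add: power_add power_mult_distrib[symmetric])
    finally have "real (card (F n)) \<le> real (4 ^ m)" by (simp only: of_nat_le_iff)
    hence "real (card (F n)) * (\<Sum>ab\<in>F n. (norm (g ab))\<^sup>2) \<le> 4 ^ m * (\<Sum>ab\<in>F n. (norm (g ab))\<^sup>2)"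
      by (intro mult_right_mono sum_nonneg) auto
    with norm_sum_sq_le_card[of g "F n"] show ?thesis unfolding c_def by linarith
  qed (simp add: c_def)
  have "(\<Sum>j<M. (norm (\<Sum>n\<in>A. b n * chi (z j) n)) ^ 4)
      = (\<Sum>j<M. (norm (\<Sum>n\<in>{1..N\<^sup>2}. c n * chi (z j) n))\<^sup>2)"
    by (simp only: sq[symmetric] norm_power) (simp add: power_mult[symmetric])
  also have "\<dots> = real M * (\<Sum>n\<in>{1..N\<^sup>2}. (norm (c n))\<^sup>2)"
    by (rule torus_sample_Parseval[OF sample order_refl])
  also have "\<dots> \<le> real M * (\<Sum>n\<in>{1..N\<^sup>2}. 4 ^ m * (\<Sum>ab\<in>F n. (norm (g ab))\<^sup>2))"
    by (intro mult_left_mono sum_mono c) auto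
  also have "\<dots> = real M * 4 ^ m * (\<Sum>n\<in>{1..N\<^sup>2}. \<Sum>ab\<in>F n. (norm (g ab))\<^sup>2)"
    by (simp add: sum_distrib_left mult_ac)
  also have "(\<Sum>n\<in>{1..N\<^sup>2}. \<Sum>ab\<in>F n. (norm (g ab))\<^sup>2) = (\<Sum>ab\<in>A \<times> A. (norm (g ab))\<^sup>2)"
    unfolding F_def using fA range by (intro sum.group) auto
  also have "\<dots> = (\<Sum>n\<in>A. (norm (b n))\<^sup>2)\<^sup>2"
    by (simp add: g_def norm_mult power_mult_distrib power2_eq_square[of "sum _ _"]
        sum_product sum.cartesian_product case_prod_unfold)
  finally show ?thesis .
qed

text \<open>For $v \ge 0$ one has $v - v^2 + v^4 \ge 0$; this is applied to $v = u_j / s$ with $s$ a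
  multiple of the $L^2$ norm $S$.\<close>

lemma first_moment_ge:
  fixes u :: "nat \<Rightarrow> real"
  assumes "\<And>j. u j \<ge> 0" "K > 0" "S \<ge> 0"
    and m2: "(\<Sum>j<M. (u j)\<^sup>2) = real M * S\<^sup>2"
    and m4: "(\<Sum>j<M. (u j) ^ 4) \<le> real M * K\<^sup>2 * S ^ 4"
  shows "real M * S \<le> 3 * K * (\<Sum>j<M. u j)"
proof (cases "S = 0")
  case True
  thus ?thesis using assms by (simp add: sum_nonneg)
next
  case False
  hence S: "S > 0" using assms by simp
  \<comment> \<open>Summing the pointwise inequality with s = c K S gives the constant c^3 / (c^2 -
    1); at c = 3/2 this is 2.7, below the claimed 3.\<close>
  define s where "s = 3 / 2 * K * S"
  have s: "s > 0" using S assms by (simp add: s_def)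
  have pt: "(u j)\<^sup>2 * s\<^sup>2 - (u j) ^ 4 \<le> u j * s ^ 3" for j
  proof -
    have "v - v\<^sup>2 + v ^ 4 \<ge> 0" if "v \<ge> 0" for v :: real
    proof -
      have "1 - v + v ^ 3 \<ge> 0"
      proof (cases "v \<le> 1")
        case False
        hence "v * 1 \<le> v * v\<^sup>2" by (intro mult_left_mono one_le_power) auto
        thus ?thesis by (simp add: power_numeral_reduce)
      qed (use that in \<open>simp add: add_nonneg_nonneg\<close>)
      hence "v * (1 - v + v ^ 3) \<ge> 0" using that by simp
      thus ?thesis by (simp add: algebra_simps power_numeral_reduce)
    qed
    from this[of "u j / s"] have "u j / s - (u j / s)\<^sup>2 + (u j / s) ^ 4 \<ge> 0"
      using assms s by simp
    hence "s ^ 4 * (u j / s - (u j / s)\<^sup>2 + (u j / s) ^ 4) \<ge> 0"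
      using s by simp
    also have "s ^ 4 * (u j / s - (u j / s)\<^sup>2 + (u j / s) ^ 4) = u j * s ^ 3 - (u j)\<^sup>2 * s\<^sup>2 + (u j) ^ 4"
      using s by (simp add: field_simps power_numeral_reduce)
    finally show ?thesis by simp
  qed
  have "real M * S\<^sup>2 * s\<^sup>2 - real M * K\<^sup>2 * S ^ 4 \<le> (\<Sum>j<M. (u j)\<^sup>2) * s\<^sup>2 - (\<Sum>j<M. (u j) ^ 4)"
    using m2 m4 by simp
  also have "\<dots> = (\<Sum>j<M. (u j)\<^sup>2 * s\<^sup>2 - (u j) ^ 4)"
    by (simp add: sum_subtractf sum_distrib_right)
  also have "\<dots> \<le> (\<Sum>j<M. u j * s ^ 3)" by (intro sum_mono pt)
  also have "\<dots> = (\<Sum>j<M. u j) * (27 / 8 * (K ^ 3 * S ^ 3))"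
    by (simp add: s_def sum_distrib_right sum_distrib_left mult_ac power_mult_distrib power_divide)
  also have "real M * S\<^sup>2 * s\<^sup>2 - real M * K\<^sup>2 * S ^ 4 = (real M * S) * (5 / 4 * (K\<^sup>2 * S ^ 3))"
    by (simp add: s_def power_mult_distrib power_divide algebra_simps power_numeral_reduce)
  finally have "(K\<^sup>2 * S ^ 3) * (5 / 4 * (real M * S)) \<le> (K\<^sup>2 * S ^ 3) * (27 / 8 * K * (\<Sum>j<M. u j))"
    by (simp add: algebra_simps power_numeral_reduce)
  hence "5 / 4 * (real M * S) \<le> 27 / 8 * K * (\<Sum>j<M. u j)"
    using S assms by simp
  hence "5 / 4 * (real M * S) \<le> 27 / 8 * (K * (\<Sum>j<M. u j))"
    by (simp only: mult.assoc)
  moreover have "0 \<le> K * (\<Sum>j<M. u j)" using assms by (simp add: sum_nonneg)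
  ultimately have "real M * S \<le> 3 * (K * (\<Sum>j<M. u j))" by linarith
  thus ?thesis by (simp only: mult.assoc)
qed

text \<open>A Khinchine-type inequality: the fourth moment constant \<open>4 ^ m\<close> is the
  square of \<open>2 ^ m\<close>, so the comparison of moments applies with
  \<open>K = 2 ^ m\<close>.\<close>

lemma first_moment_chi_ge:
  assumes sample: "torus_sample (N\<^sup>2) M z" and A: "A \<subseteq> {1..N}"
    and deg: "\<And>n. n \<in> A \<Longrightarrow> Omega n \<le> m"
  shows "real M * sqrt (\<Sum>n\<in>A. (norm (b n))\<^sup>2) \<le> 3 * 2 ^ m * (\<Sum>j<M. norm (\<Sum>n\<in>A. b n * chi (z j) n))"
proof (rule first_moment_ge)
  have nn: "(\<Sum>n\<in>A. (norm (b n))\<^sup>2) \<ge> 0" by (intro sum_nonneg) auto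
  have "N \<le> N\<^sup>2" by (simp add: power2_nat_le_imp_le)
  hence "A \<subseteq> {1..N\<^sup>2}" using A by fastforce
  thus "(\<Sum>j<M. (norm (\<Sum>n\<in>A. b n * chi (z j) n))\<^sup>2) = real M * (sqrt (\<Sum>n\<in>A. (norm (b n))\<^sup>2))\<^sup>2"
    using nn by (simp add: torus_sample_Parseval[OF sample])
  have "(sqrt (\<Sum>n\<in>A. (norm (b n))\<^sup>2)) ^ 4 = (\<Sum>n\<in>A. (norm (b n))\<^sup>2)\<^sup>2"
    using nn power_mult[of "sqrt (\<Sum>n\<in>A. (norm (b n))\<^sup>2)" 2 2] by simp
  thus "(\<Sum>j<M. (norm (\<Sum>n\<in>A. b n * chi (z j) n)) ^ 4)
      \<le> real M * (2 ^ m)\<^sup>2 * (sqrt (\<Sum>n\<in>A. (norm (b n))\<^sup>2)) ^ 4"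
    using fourth_moment_le[OF sample A deg, of b]
    by (simp add: power_mult[symmetric] mult.commute[of _ 2]) (simp add: power_mult)
qed (auto intro!: sum_nonneg)

section \<open>Mixed norm inequality\<close>

text \<open>An arbitrary bound \<open>B\<close> replaces the supremum norm, so that bounds are
  easily passed on to homogeneous parts and no supremum over the torus has to be handled.\<close>

definition torus_bounded :: "nat set \<Rightarrow> (nat \<Rightarrow> complex) \<Rightarrow> real \<Rightarrow> bool" where
  "torus_bounded A a B \<longleftrightarrow> (\<forall>z. (\<forall>p. norm (z p) = 1) \<longrightarrow> norm (\<Sum>n\<in>A. a n * chi z n) \<le> B)"

lemma torus_boundedD:
  "torus_bounded A a B \<Longrightarrow> (\<And>p. norm (z p) = 1) \<Longrightarrow> norm (\<Sum>n\<in>A. a n * chi z n) \<le> B"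
  by (simp add: torus_bounded_def)

lemma torus_bounded_nonneg: "torus_bounded A a B \<Longrightarrow> B \<ge> 0"
  by (rule order_trans[OF norm_ge_zero torus_boundedD[of A a B "\<lambda>_. 1"]]) auto

lemma torus_bounded_L2:
  assumes "A \<subseteq> {1..N}" "torus_bounded A a B"
  shows "sqrt (\<Sum>n\<in>A. (norm (a n))\<^sup>2) \<le> B"
proof -
  obtain M z where z: "torus_sample N M z" using torus_sample_exists by blast
  have M: "M > 0" using z by (simp add: torus_sample_def)
  have B: "B \<ge> 0" using assms torus_bounded_nonneg by blast
  have "real M * (\<Sum>n\<in>A. (norm (a n))\<^sup>2) = (\<Sum>j<M. (norm (\<Sum>n\<in>A. a n * chi (z j) n))\<^sup>2)"
    by (rule torus_sample_Parseval[OF z assms(1), symmetric])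
  also have "\<dots> \<le> (\<Sum>j<M. B\<^sup>2)"
    using z by (intro sum_mono power_mono torus_boundedD[OF assms(2)]) (auto simp: torus_sample_def)
  finally have "(\<Sum>n\<in>A. (norm (a n))\<^sup>2) \<le> B\<^sup>2" using M by simp
  thus ?thesis using B by (simp add: real_le_lsqrt sum_nonneg)
qed

text \<open>The sum over $q$ is the gradient of the polynomial; its subset sums are derivatives in the
  direction of rotating only the variables in $S$.\<close>

lemma gradient_bound:
  assumes "finite A" "0 \<notin> A" "finite Q" "\<And>q. q \<in> Q \<Longrightarrow> prime q"
    and bd: "torus_bounded A a B" and z: "\<And>p. norm (z p) = 1"
    and deg: "\<And>n. n \<in> A \<Longrightarrow> Omega n \<le> m"
  shows "(\<Sum>q\<in>Q. norm (\<Sum>n\<in>A. of_nat (multiplicity q n) * a n * chi z n)) \<le> 4 * (real (m\<^sup>2) * B)"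
proof (rule sum_norm_le_if_subset_sums_le[OF assms(3)])
  fix S assume S: "S \<subseteq> Q"
  hence S': "finite S" "\<And>p. p \<in> S \<Longrightarrow> prime p" using assms finite_subset by blast+
  define f where "f = (\<lambda>n. \<Sum>q\<in>S. multiplicity q n)"
  have pos: "n > 0" if "n \<in> A" for n using assms(2) that by (cases n) auto
  have f: "f n \<le> m" if "n \<in> A" for n
    using sum_multiplicity_le_Omega[OF pos[OF that] S'] deg[OF that] by (simp add: f_def)
  have P: "norm (\<Sum>n | n \<in> A \<and> f n = k. a n * chi z n) \<le> B" for k
  proof (rule norm_coeff_le[OF assms(1)])
    fix u :: complex assume u: "norm u = 1"
    have "(\<Sum>n\<in>A. a n * chi z n * u ^ f n)
        = (\<Sum>n\<in>A. a n * chi (\<lambda>p. if p \<in> S then u * z p else z p) n)"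
      using pos by (intro sum.cong refl) (simp add: chi_rotate[OF _ S'] f_def)
    thus "norm (\<Sum>n\<in>A. a n * chi z n * u ^ f n) \<le> B"
      using torus_boundedD[OF bd, of "\<lambda>p. if p \<in> S then u * z p else z p"] u z
      by (simp add: norm_mult)
  qed
  \<comment> \<open>By \<open>P\<close>, the part of degree \<open>k\<close> in the variables of
    \<open>S\<close> is again bounded by \<open>B\<close>; the derivative multiplies it by
    \<open>k\<close>.\<close>
  have B: "B \<ge> 0" using bd torus_bounded_nonneg by blast
  have "(\<Sum>q\<in>S. \<Sum>n\<in>A. of_nat (multiplicity q n) * a n * chi z n)
      = (\<Sum>n\<in>A. of_nat (f n) * (a n * chi z n))"
    by (subst sum.swap) (simp add: f_def sum_distrib_right sum_distrib_left mult_ac)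
  also have "\<dots> = (\<Sum>k\<in>{..m}. \<Sum>n | n \<in> A \<and> f n = k. of_nat (f n) * (a n * chi z n))"
    using assms(1) f by (intro sum.group[symmetric]) auto
  also have "\<dots> = (\<Sum>k\<in>{..m}. of_nat k * (\<Sum>n | n \<in> A \<and> f n = k. a n * chi z n))"
    by (simp add: sum_distrib_left)
  also have "norm \<dots> \<le> (\<Sum>k\<in>{..m}. real k * B)"
    by (intro sum_norm_le) (simp add: norm_mult mult_left_mono P)
  \<comment> \<open>Dropping the zero term leaves \<open>m\<close> terms and gives m^2 instead of m
    (m + 1).\<close>
  also have "\<dots> = (\<Sum>k\<in>{1..m}. real k * B)"
    by (intro sum.mono_neutral_right) auto
  also have "\<dots> \<le> (\<Sum>k\<in>{1..m}. real m * B)"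
    using B by (intro sum_mono mult_right_mono) auto
  also have "\<dots> = real (m\<^sup>2) * B" by (simp add: power2_eq_square)
  finally show "norm (\<Sum>q\<in>S. \<Sum>n\<in>A. of_nat (multiplicity q n) * a n * chi z n) \<le> real (m\<^sup>2) * B" .
qed

lemma mixed_norm_inequality:
  assumes A: "A \<subseteq> {1..N}" and Q: "finite Q" "\<And>q. q \<in> Q \<Longrightarrow> prime q"
    and bd: "torus_bounded A a B"
    and deg: "\<And>n. n \<in> A \<Longrightarrow> Omega n \<le> m"
  shows "(\<Sum>q\<in>Q. sqrt (\<Sum>n | n \<in> A \<and> q dvd n. (norm (a n))\<^sup>2)) \<le> 12 * 2 ^ m * real (m\<^sup>2) * B"
proof -
  obtain M z where z: "torus_sample (N\<^sup>2) M z" using torus_sample_exists by blast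
  have M: "M > 0" and z1: "norm (z j p) = 1" for j p using z by (auto simp: torus_sample_def)
  have fA: "finite A" "0 \<notin> A" using A finite_subset[OF A] by auto
  define D where "D = (\<lambda>q j. norm (\<Sum>n\<in>A. of_nat (multiplicity q n) * a n * chi (z j) n))"
  have D: "real M * sqrt (\<Sum>n | n \<in> A \<and> q dvd n. (norm (a n))\<^sup>2) \<le> 3 * 2 ^ m * (\<Sum>j<M. D q j)"
    if q: "q \<in> Q" for q
  proof -
    \<comment> \<open>The right side has the coefficients of the derivative in the variable
      \<open>q\<close>, whose factors \<open>multiplicity q n\<close> are at least 1 on multiples of
      \<open>q\<close>.\<close>
    have "(\<Sum>n | n \<in> A \<and> q dvd n. (norm (a n))\<^sup>2)
        \<le> (\<Sum>n | n \<in> A \<and> q dvd n. (norm (of_nat (multiplicity q n) * a n))\<^sup>2)"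
    proof (rule sum_mono)
      fix n assume n: "n \<in> {n \<in> A. q dvd n}"
      have "n \<noteq> 0" using n fA(2) by (intro notI) simp
      hence "multiplicity q n > 0"
        using n Q(2)[OF q] prime_multiplicity_gt_zero_iff[of q n] by simp
      hence "1 * norm (a n) \<le> norm (of_nat (multiplicity q n) :: complex) * norm (a n)"
        by (intro mult_right_mono) auto
      thus "(norm (a n))\<^sup>2 \<le> (norm (of_nat (multiplicity q n) * a n))\<^sup>2"
        by (intro power_mono) (auto simp: norm_mult)
    qed
    also have "\<dots> \<le> (\<Sum>n\<in>A. (norm (of_nat (multiplicity q n) * a n))\<^sup>2)"
      using fA by (intro sum_mono2) auto
    finally have "real M * sqrt (\<Sum>n | n \<in> A \<and> q dvd n. (norm (a n))\<^sup>2)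
        \<le> real M * sqrt (\<Sum>n\<in>A. (norm (of_nat (multiplicity q n) * a n))\<^sup>2)"
      by (intro mult_left_mono) auto
    also have "\<dots> \<le> 3 * 2 ^ m * (\<Sum>j<M. D q j)"
      unfolding D_def by (rule first_moment_chi_ge[OF z A deg])
    finally show ?thesis .
  qed
  have "real M * (\<Sum>q\<in>Q. sqrt (\<Sum>n | n \<in> A \<and> q dvd n. (norm (a n))\<^sup>2))
      \<le> (\<Sum>q\<in>Q. 3 * 2 ^ m * (\<Sum>j<M. D q j))"
    unfolding sum_distrib_left[of "real M"] by (intro sum_mono D)
  \<comment> \<open>At each sample point the sum over \<open>q\<close> is a gradient norm, bounded
    independently of the number of primes. The 12 is 3 from the moments times 4 from the
    gradient.\<close>
  also have "\<dots> = 3 * 2 ^ m * (\<Sum>j<M. \<Sum>q\<in>Q. D q j)"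
    unfolding sum_distrib_left[symmetric] by (subst sum.swap) simp
  also have "\<dots> \<le> 3 * 2 ^ m * (\<Sum>j<M. 4 * (real (m\<^sup>2) * B))"
    unfolding D_def
    by (intro mult_left_mono sum_mono gradient_bound[OF fA Q bd z1 deg]) auto
  also have "\<dots> = real M * (12 * 2 ^ m * real (m\<^sup>2) * B)" by simp
  finally show ?thesis using M by simp
qed

text \<open>For each prime $q$ the Cauchy-Schwarz inequality is applied to the $n$ with largest prime
  factor $q$.\<close>

lemma weighted_sum_le:
  fixes w :: "nat \<Rightarrow> real"
  assumes A: "A \<subseteq> {2..N}" and bd: "torus_bounded A a B"
    and deg: "\<And>n. n \<in> A \<Longrightarrow> Omega n \<le> m"
    and G: "\<And>q. prime q \<Longrightarrow> (\<Sum>n | n \<in> A \<and> Max (prime_factors n) = q. (w n)\<^sup>2) \<le> G"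
  shows "(\<Sum>n\<in>A. norm (a n) * w n) \<le> sqrt G * (12 * 2 ^ m * real (m\<^sup>2) * B)"
proof -
  define Q where "Q = {q. prime q \<and> q \<le> N}"
  have Q: "finite Q" "\<And>q. q \<in> Q \<Longrightarrow> prime q" by (auto simp: Q_def)
  have fA: "finite A" "A \<subseteq> {1..N}" using A finite_subset[OF A] by auto
  have G0: "G \<ge> 0" by (rule order_trans[OF sum_nonneg G[of 2]]) auto
  have lp: "prime (Max (prime_factors n)) \<and> Max (prime_factors n) dvd n" if "n \<in> A" for n
  proof -
    have "n \<noteq> 0" "n \<noteq> 1" using that A by auto
    hence "prime_factors n \<noteq> {}" by (auto simp: prime_factorization_empty_iff)
    hence "Max (prime_factors n) \<in> prime_factors n" by (intro Max_in) auto
    thus ?thesis by (auto simp: in_prime_factors_iff)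
  qed
  have lpQ: "Max (prime_factors n) \<in> Q" if "n \<in> A" for n
  proof -
    have "Max (prime_factors n) \<le> n" using lp[OF that] that A by (intro dvd_imp_le) auto
    thus ?thesis using lp[OF that] that A by (auto simp: Q_def)
  qed
  have "(\<Sum>n\<in>A. norm (a n) * w n)
      = (\<Sum>q\<in>Q. \<Sum>n | n \<in> A \<and> Max (prime_factors n) = q. norm (a n) * w n)"
    using fA Q lpQ by (intro sum.group[symmetric]) auto
  also have "\<dots> \<le> (\<Sum>q\<in>Q. sqrt G * sqrt (\<Sum>n | n \<in> A \<and> q dvd n. (norm (a n))\<^sup>2))"
  proof (rule sum_mono)
    fix q assume q: "q \<in> Q"
    let ?E = "{n \<in> A. Max (prime_factors n) = q}"
    have "(\<Sum>n\<in>?E. norm (a n) * w n) \<le> sqrt (\<Sum>n\<in>?E. (norm (a n))\<^sup>2) * sqrt (\<Sum>n\<in>?E. (w n)\<^sup>2)"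
      using L2_set_mult_ineq[of "\<lambda>n. norm (a n)" w ?E] unfolding L2_set_def
      by (rule order_trans[rotated]) (intro sum_mono, simp add: mult_left_mono)
    \<comment> \<open>Only the coefficient sum is enlarged from largest prime factor
      \<open>q\<close> to all multiples of \<open>q\<close>; the weight sum stays restricted, which
      keeps it below \<open>G\<close>.\<close>
    also have "\<dots> \<le> sqrt (\<Sum>n | n \<in> A \<and> q dvd n. (norm (a n))\<^sup>2) * sqrt G"
      using fA lp G[OF Q(2)[OF q]]
      by (intro mult_mono real_sqrt_le_mono sum_mono2 real_sqrt_ge_zero sum_nonneg) auto
    finally show "(\<Sum>n\<in>?E. norm (a n) * w n)
        \<le> sqrt G * sqrt (\<Sum>n | n \<in> A \<and> q dvd n. (norm (a n))\<^sup>2)"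
      by (simp add: mult.commute)
  qed
  also have "\<dots> \<le> sqrt G * (12 * 2 ^ m * real (m\<^sup>2) * B)"
    unfolding sum_distrib_left[symmetric] using G0
    by (intro mult_left_mono mixed_norm_inequality[OF fA(2) Q bd deg]) auto
  finally show ?thesis .
qed

section \<open>Passing from the polytorus to vertical lines\<close>

text \<open>Unique factorization: moving the negative coefficients to the other side and
  exponentiating gives two products of prime powers that agree.\<close>

lemma ln_primes_independent:
  fixes c :: "nat \<Rightarrow> int"
  assumes P: "finite P" "\<And>p. p \<in> P \<Longrightarrow> prime p"
    and eq: "(\<Sum>p\<in>P. of_int (c p) * ln (real p)) = 0" and "q \<in> P"
  shows "c q = 0"
proof -
  have pos: "p > 0" if "p \<in> P" for p using P(2)[OF that] by (rule prime_gt_0_nat)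
  have ln_prod: "ln (real (\<Prod>p\<in>P. p ^ e p)) = (\<Sum>p\<in>P. real (e p) * ln (real p))" for e
    unfolding of_nat_prod using pos P(1) by (subst ln_prod) (auto simp: ln_realpow)
  have "(\<Sum>p\<in>P. of_int (c p) * ln (real p))
      = (\<Sum>p\<in>P. real (nat (c p)) * ln (real p)) - (\<Sum>p\<in>P. real (nat (- c p)) * ln (real p))"
    unfolding sum_subtractf[symmetric]
  proof (rule sum.cong[OF refl])
    fix p
    show "of_int (c p) * ln (real p) = real (nat (c p)) * ln (real p) - real (nat (- c p)) * ln (real p)"
      by (cases "c p \<ge> 0") (auto simp: algebra_simps)
  qed
  hence "ln (real (\<Prod>p\<in>P. p ^ nat (c p))) = ln (real (\<Prod>p\<in>P. p ^ nat (- c p)))"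
    using eq by (simp only: ln_prod)
  hence "(\<Prod>p\<in>P. p ^ nat (c p)) = (\<Prod>p\<in>P. p ^ nat (- c p))"
    using pos by (subst (asm) ln_inj_iff) (auto intro!: prod_pos simp del: of_nat_prod)
  hence "multiplicity q (\<Prod>p\<in>P. p ^ nat (c p)) = multiplicity q (\<Prod>p\<in>P. p ^ nat (- c p))"
    by simp
  hence "nat (c q) = nat (- c q)"
    using P \<open>q \<in> P\<close> by (subst (asm) (1 2) multiplicity_prod_prime_powers) auto
  thus ?thesis by simp
qed

text \<open>The factor -1/(2 pi) measures the phase of p^(-it) in full turns, so the integers
  \<open>h p\<close> absorb whole turns and \<open>\<alpha> p\<close> is the target phase.\<close>

lemma Kronecker_primes:
  assumes "finite P" "\<And>p. p \<in> P \<Longrightarrow> prime p" "e > 0"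
  shows "\<exists>t h. \<forall>p\<in>P. \<bar>t * (- ln (real p) / (2 * pi)) - of_int (h p) - \<alpha> p\<bar> < e"
proof -
  define k where "k = card P"
  obtain f where f: "bij_betw f {..<k} P"
    using ex_bij_betw_nat_finite[OF assms(1)] unfolding k_def atLeast0LessThan by blast
  define \<theta> where "\<theta> = (\<lambda>p::nat. - ln (real p) / (2 * pi))"
  have inj\<theta>: "inj_on \<theta> P"
  proof (rule inj_onI)
    fix p q assume "p \<in> P" "q \<in> P" "\<theta> p = \<theta> q"
    thus "p = q" using assms(2)[of p] assms(2)[of q]
      by (auto simp: \<theta>_def prime_gt_0_nat)
  qed
  \<comment> \<open>Kronecker's theorem asks for independence over the integers, so the reals are
    viewed as a module over them.\<close>
  interpret Modules.module "(\<lambda>r. (*) (real_of_int r))"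
    by (simp add: Modules.module.intro distrib_left mult.commute)
  have "independent (\<theta> ` P)"
    unfolding dependent_explicit
  proof (intro notI, elim exE conjE bexE)
    fix T u v assume T: "finite T" "T \<subseteq> \<theta> ` P" "(\<Sum>v\<in>T. real_of_int (u v) * v) = 0"
      "v \<in> T" "u v \<noteq> (0 :: int)"
    obtain P' where P': "P' \<subseteq> P" "T = \<theta> ` P'" using T(2) by (meson subset_imageE)
    have inj: "inj_on \<theta> P'" using inj\<theta> P' inj_on_subset by blast
    obtain q where q: "q \<in> P'" "v = \<theta> q" using T P' by blast
    have "(\<Sum>p\<in>P'. of_int (u (\<theta> p)) * \<theta> p) = 0"
      using T(3) P' inj by (simp add: sum.reindex)
    hence "(\<Sum>p\<in>P'. of_int (u (\<theta> p)) * \<theta> p) * (- 2 * pi) = 0" by simp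
    hence "(\<Sum>p\<in>P'. of_int (u (\<theta> p)) * ln (real p)) = 0"
      unfolding sum_distrib_right by (simp add: \<theta>_def)
    from ln_primes_independent[OF _ _ this q(1)] have "u (\<theta> q) = 0"
      using assms P' finite_subset by blast
    thus False using T q by simp
  qed
  hence ind: "independent ((\<theta> \<circ> f) ` {..<k})"
    using f by (metis bij_betw_imp_surj_on image_comp)
  have inj: "inj_on (\<theta> \<circ> f) {..<k}"
    using f inj\<theta> by (auto simp: bij_betw_def intro: comp_inj_on)
  obtain t h where "\<And>i. i < k \<Longrightarrow> \<bar>t * (\<theta> \<circ> f) i - of_int (h i) - (\<alpha> \<circ> f) i\<bar> < e"
    using Kronecker_thm_1[OF ind inj assms(3), of "\<alpha> \<circ> f"] by blast
  hence th: "\<bar>t * \<theta> (f i) - of_int (h i) - \<alpha> (f i)\<bar> < e" if "i < k" for i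
    using that by simp
  show ?thesis
  proof (intro exI ballI)
    fix p assume p: "p \<in> P"
    have "inv_into {..<k} f p \<in> {..<k}" "f (inv_into {..<k} f p) = p"
      using f p by (auto simp: bij_betw_def inv_into_into f_inv_into_f)
    thus "\<bar>t * (- ln (real p) / (2 * pi)) - of_int (h (inv_into {..<k} f p)) - \<alpha> p\<bar> < e"
      using th[of "inv_into {..<k} f p"] by (simp add: \<theta>_def)
  qed
qed

lemma chi_powr:
  assumes "n > 0"
  shows "chi (\<lambda>p. of_nat p powr s) n = of_nat n powr s"
proof -
  have "(\<And>p. p \<in># A \<Longrightarrow> p > 0) \<Longrightarrow> prod_mset (image_mset (\<lambda>p. of_nat p powr s) A)
      = of_nat (prod_mset A) powr s" for A :: "nat multiset"
    by (induction A) (auto simp: powr_times_real)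
  from this[of "prime_factorization n"] show ?thesis
    using assms by (simp add: chi_def prime_factors_gt_0_nat prod_mset_prime_factorization_nat)
qed

lemma dirichlet_poly_chi:
  "dirichlet_poly x a s = (\<Sum>n\<in>nats_upto x. a n * chi (\<lambda>p. of_nat p powr (- s)) n)"
  unfolding dirichlet_poly_def by (intro sum.cong refl) (auto simp: chi_powr nats_upto_def)

text \<open>Kronecker's theorem: the vertical flow is dense in the polytorus.\<close>

lemma torus_bounded_if_vertical_bounded:
  assumes "\<And>t::real. norm (dirichlet_poly x a (\<i> * of_real t)) \<le> B"
  shows "torus_bounded (nats_upto x) a B"
  unfolding torus_bounded_def
proof (intro allI impI)
  fix z :: "nat \<Rightarrow> complex" assume z: "\<forall>p. norm (z p) = 1"
  define P where "P = {p. prime p \<and> real p \<le> x}"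
  have "P \<subseteq> nats_upto x" using prime_gt_0_nat by (auto simp: P_def nats_upto_def Suc_le_eq)
  hence P: "finite P" "\<And>p. p \<in> P \<Longrightarrow> prime p"
    using finite_subset[OF _ finite_nats_upto] by (auto simp: P_def)
  have "\<exists>t h. \<forall>p\<in>P. \<bar>t * (- ln (real p) / (2 * pi)) - of_int (h p) - Arg (z p) / (2 * pi)\<bar>
      < inverse (real (Suc k))" for k
    by (rule Kronecker_primes[OF P positive_imp_inverse_positive[OF of_nat_0_less_iff[THEN iffD2, OF zero_less_Suc]]])
  then obtain t h where th: "\<And>k p. p \<in> P \<Longrightarrow>
      \<bar>t k * (- ln (real p) / (2 * pi)) - of_int (h k p) - Arg (z p) / (2 * pi)\<bar> < inverse (real (Suc k))"
    by metis
  have lim: "(\<lambda>k. of_nat p powr (- (\<i> * of_real (t k)))) \<longlonglongrightarrow> z p" if p: "p \<in> P" for p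
  proof -
    define r where "r = (\<lambda>k. t k * (- ln (real p) / (2 * pi)) - of_int (h k p))"
    have "norm (r k - Arg (z p) / (2 * pi)) \<le> inverse (real (Suc k))" for k
      using th[OF p, of k] unfolding r_def real_norm_def by (rule less_imp_le)
    hence "(\<lambda>k. r k - Arg (z p) / (2 * pi)) \<longlonglongrightarrow> 0"
      by (intro Lim_null_comparison[OF always_eventually LIMSEQ_inverse_real_of_nat] allI)
    hence "r \<longlonglongrightarrow> Arg (z p) / (2 * pi)" by (simp add: LIM_zero_iff)
    hence "(\<lambda>k. cis (2 * pi * r k)) \<longlonglongrightarrow> cis (2 * pi * (Arg (z p) / (2 * pi)))"
      by (intro tendsto_intros)
    moreover have "cis (2 * pi * (Arg (z p) / (2 * pi))) = z p"
    proof -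
      have "z p \<noteq> 0" using z by (metis norm_zero zero_neq_one)
      hence "cis (Arg (z p)) = z p" using z by (simp add: cis_Arg sgn_eq)
      thus ?thesis by simp
    qed
    moreover have "cis (2 * pi * r k) = of_nat p powr (- (\<i> * of_real (t k)))" for k
    proof -
      have "p > 0" using P(2)[OF p] by (rule prime_gt_0_nat)
      have "2 * pi * r k = - t k * ln (real p) - 2 * pi * of_int (h k p)"
        by (simp add: r_def algebra_simps)
      hence "cis (2 * pi * r k) = cis (- t k * ln (real p)) / cis (2 * pi * of_int (h k p))"
        by (simp only: cis_divide)
      also have "\<dots> = cis (- t k * ln (real p))" by (simp only: cis_multiple_2pi Ints_of_int) simp
      also have "\<dots> = of_nat p powr (- (\<i> * of_real (t k)))"
        using \<open>p > 0\<close> by (simp add: powr_def cis_conv_exp Ln_of_nat mult_ac)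
      finally show ?thesis .
    qed
    ultimately show ?thesis by simp
  qed
  have "(\<lambda>k. \<Sum>n\<in>nats_upto x. a n * chi (\<lambda>p. of_nat p powr (- (\<i> * of_real (t k)))) n)
      \<longlonglongrightarrow> (\<Sum>n\<in>nats_upto x. a n * chi z n)"
    unfolding chi_conv_prod
  proof (rule tendsto_sum, rule tendsto_mult[OF tendsto_const], rule tendsto_prod, rule tendsto_power, rule lim)
    fix n p assume "n \<in> nats_upto x" "p \<in> prime_factors n"
    hence "prime p" "p \<le> n" "real n \<le> x"
      by (auto simp: nats_upto_def in_prime_factors_iff intro: dvd_imp_le)
    thus "p \<in> P" by (simp add: P_def)
  qed
  thus "norm (\<Sum>n\<in>nats_upto x. a n * chi z n) \<le> B"
    by (rule Lim_bounded[OF tendsto_norm])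
      (use assms in \<open>auto simp: dirichlet_poly_chi[symmetric]\<close>)
qed

text \<open>The maximum modulus principle is applied in one variable at a time.\<close>

lemma torus_bounded_imp_polydisc_bounded:
  assumes fA: "finite A" "0 \<notin> A" and bd: "torus_bounded A a B"
    and z: "\<And>p. prime p \<Longrightarrow> norm (z p) \<le> 1"
  shows "norm (\<Sum>n\<in>A. a n * chi z n) \<le> B"
proof -
  define P where "P = (\<Union>n\<in>A. prime_factors n)"
  have P: "finite P" "\<And>p. p \<in> P \<Longrightarrow> prime p" using fA by (auto simp: P_def in_prime_factors_iff)
  have main: "norm (\<Sum>n\<in>A. a n * chi z n) \<le> B"
    if "finite S" "\<And>p. p \<in> S \<Longrightarrow> prime p \<and> norm (z p) \<le> 1" "\<And>p. p \<notin> S \<Longrightarrow> norm (z p) = 1" for S z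
    using that
  proof (induction S arbitrary: z rule: finite_induct)
    case empty
    thus ?case using torus_boundedD[OF bd] by simp
  next
    case (insert q S)
    \<comment> \<open>The variable at \<open>q\<close> is set to 1 instead of being divided out,
      since \<open>z q\<close> may vanish.\<close>
    define c where "c = (\<lambda>n. a n * chi (z(q := 1)) n)"
    have eq: "(\<Sum>n\<in>A. c n * u ^ multiplicity q n) = (\<Sum>n\<in>A. a n * chi (z(q := u)) n)" for u
    proof (rule sum.cong[OF refl])
      fix n assume "n \<in> A"
      hence "n > 0" using fA by (cases n) auto
      moreover have "(\<lambda>p. if p \<in> {q} then u * (z(q := 1)) p else (z(q := 1)) p) = z(q := u)"
        by auto
      ultimately have "chi (z(q := u)) n = u ^ (\<Sum>q\<in>{q}. multiplicity q n) * chi (z(q := 1)) n"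
        using chi_rotate[of n "{q}" u "z(q := 1)"] insert.prems by (simp only:) auto
      thus "c n * u ^ multiplicity q n = a n * chi (z(q := u)) n"
        by (simp add: c_def)
    qed
    have "norm (\<Sum>n\<in>A. c n * z q ^ multiplicity q n) \<le> B"
    proof (rule maximum_modulus_frontier[where S = "cball 0 1" and \<xi> = "z q"
          and f = "\<lambda>u. \<Sum>n\<in>A. c n * u ^ multiplicity q n"])
      show "(\<lambda>u. \<Sum>n\<in>A. c n * u ^ multiplicity q n) holomorphic_on interior (cball 0 1)"
        by (intro holomorphic_intros)
      show "continuous_on (closure (cball 0 1)) (\<lambda>u. \<Sum>n\<in>A. c n * u ^ multiplicity q n)"
        by (intro continuous_intros)
      show "norm (\<Sum>n\<in>A. c n * u ^ multiplicity q n) \<le> B" if "u \<in> frontier (cball 0 1)" for u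
      proof -
        have "norm u = 1" using that by simp
        thus ?thesis unfolding eq
          using insert.prems insert.hyps by (intro insert.IH) auto
      qed
    qed (use insert.prems in auto)
    thus ?case unfolding eq by simp
  qed
  \<comment> \<open>The induction requires modulus 1 outside a finite set, so variables that do not
    occur are reset to 1.\<close>
  have "(\<Sum>n\<in>A. a n * chi z n) = (\<Sum>n\<in>A. a n * chi (\<lambda>p. if p \<in> P then z p else 1) n)"
    by (intro sum.cong refl arg_cong2[of _ _ _ _ "(*)"] chi_cong) (auto simp: P_def)
  also have "norm \<dots> \<le> B"
    by (rule main[of P]) (use P z in auto)
  finally show ?thesis .
qed

section \<open>Equality of the suprema over the half-plane and over its boundary line\<close>

lemma bdd_above_vertical: "bdd_above (range (\<lambda>t::real. norm (dirichlet_poly x a (\<i> * of_real t))))"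
  using bdd_above_dirichlet_poly[of "range (\<lambda>t::real. \<i> * of_real t)" x a]
  by (simp add: image_image image_subset_iff)

lemma torus_bounded_vertical_sup:
  "torus_bounded (nats_upto x) a (SUP t::real. norm (dirichlet_poly x a (\<i> * of_real t)))"
  by (intro torus_bounded_if_vertical_bounded cSUP_upper bdd_above_vertical) simp

lemma dirichlet_sup_le:
  assumes "torus_bounded (nats_upto x) a B"
  shows "dirichlet_sup x a \<le> B"
  unfolding dirichlet_sup_def
proof (rule cSUP_least)
  fix s :: complex assume s: "s \<in> {s. Re s > 0}"
  show "norm (dirichlet_poly x a s) \<le> B"
    unfolding dirichlet_poly_chi
  proof (rule torus_bounded_imp_polydisc_bounded[OF finite_nats_upto _ assms])
    fix p :: nat assume "prime p"
    hence "p \<ge> 1" using prime_gt_0_nat[of p] by simp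
    moreover from this have "real p powr (- Re s) \<le> 1"
      using s by (simp add: powr_minus field_simps ge_one_powr_ge_zero)
    ultimately show "norm (of_nat p powr (- s) :: complex) \<le> 1"
      by (simp add: norm_nat_powr_minus)
  qed (auto simp: nats_upto_def)
qed (auto intro: exI[of _ 1])

text \<open>The half-plane is open, so the boundary line is reached by continuity, letting the real
  part tend to 0 from the right.\<close>

lemma vertical_le_dirichlet_sup: "norm (dirichlet_poly x a (\<i> * of_real t)) \<le> dirichlet_sup x a"
proof (rule tendsto_upperbound)
  have "dirichlet_poly x a s = (\<Sum>n\<in>nats_upto x. a n * exp (- s * Ln (of_nat n)))" for s
    unfolding dirichlet_poly_def by (intro sum.cong refl) (auto simp: powr_def nats_upto_def)
  thus "((\<lambda>d. norm (dirichlet_poly x a (of_real d + \<i> * of_real t)))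
      \<longlongrightarrow> norm (dirichlet_poly x a (\<i> * of_real t))) (at_right 0)"
    by (auto intro!: tendsto_eq_intros)
  show "eventually (\<lambda>d. norm (dirichlet_poly x a (of_real d + \<i> * of_real t)) \<le> dirichlet_sup x a) (at_right 0)"
    using eventually_at_right_less[of 0]
    by eventually_elim (auto simp: dirichlet_sup_def intro!: cSUP_upper bdd_above_dirichlet_poly)
qed simp

lemma dirichlet_sup_eq_vertical:
  "dirichlet_sup x a = (SUP t::real. norm (dirichlet_poly x a (\<i> * of_real t)))"
  by (intro antisym dirichlet_sup_le torus_bounded_vertical_sup cSUP_least vertical_le_dirichlet_sup) simp

lemma torus_bounded_dirichlet_sup: "torus_bounded (nats_upto x) a (dirichlet_sup x a)"
  using torus_bounded_vertical_sup by (simp add: dirichlet_sup_eq_vertical)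

section \<open>Chebyshev's estimates\<close>

lemma prod_primes_dvd:
  fixes n :: nat
  assumes "finite P" "\<And>p. p \<in> P \<Longrightarrow> prime p \<and> p dvd n"
  shows "\<Prod>P dvd n"
  using assms
proof (induction P rule: finite_induct)
  case (insert q P)
  have "coprime q (\<Prod>P)"
  proof (rule prod_coprime_right)
    fix p assume "p \<in> P"
    hence "prime p" "prime q" "p \<noteq> q" using insert by auto
    thus "coprime q p" by (intro primes_coprime) auto
  qed
  thus ?case using insert by (simp add: divides_mult)
qed simp

text \<open>Erdos's argument: the primes in (m + 1, 2m + 1] divide the binomial coefficient of 2m +
  1 over m, which is at most 4^m because the coefficients up to the m-th make up half of 2^(2m +
  1).\<close>

lemma primorial_le: "\<Prod>{p. prime p \<and> p \<le> n} \<le> (4 :: nat) ^ n"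
proof (induction n rule: less_induct)
  case (less n)
  have "n \<le> 1 \<or> n = 2 \<or> (n > 2 \<and> even n) \<or> (\<exists>m\<ge>1. n = 2 * m + 1)"
    by presburger
  then consider "n \<le> 1" | "n = 2" | "n > 2" "even n" | m where "n = 2 * m + 1" "m \<ge> 1"
    by blast
  thus ?case
  proof cases
    case 1
    hence "\<not> (prime p \<and> p \<le> n)" for p using prime_ge_2_nat[of p] by auto
    hence "{p. prime p \<and> p \<le> n} = {}" by blast
    thus ?thesis by (simp only: prod.empty) simp
  next
    case 2
    hence "(prime p \<and> p \<le> n) = (p = 2)" for p using prime_ge_2_nat[of p] by auto
    hence "{p. prime p \<and> p \<le> n} = {2}" by blast
    thus ?thesis using 2 by simp
  next
    case 3
    hence "\<not> prime n" using prime_odd_nat[of n] by auto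
    hence "{p. prime p \<and> p \<le> n} = {p. prime p \<and> p \<le> n - 1}"
      using 3 by (auto simp: le_less Suc_le_eq)
    also have "\<Prod>\<dots> \<le> 4 ^ (n - 1)" using 3 by (intro less) auto
    also have "\<dots> \<le> (4 :: nat) ^ n" by (intro power_increasing) auto
    finally show ?thesis .
  next
    case (4 m)
    let ?A = "{p. prime p \<and> p \<le> m + 1}" and ?B = "{p. prime p \<and> m + 1 < p \<and> p \<le> 2 * m + 1}"
    have "{p. prime p \<and> p \<le> n} = ?A \<union> ?B" using 4 by auto
    hence "\<Prod>{p. prime p \<and> p \<le> n} = \<Prod>?A * \<Prod>?B"
      by (simp add: prod.union_disjoint disjoint_iff)
    also have "\<Prod>?A \<le> 4 ^ (m + 1)" using 4 by (intro less) auto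
    also have "\<Prod>?B \<le> (2 * m + 1) choose m"
    proof (rule dvd_imp_le[OF prod_primes_dvd])
      fix p assume p: "p \<in> ?B"
      have "p dvd fact (2 * m + 1)" using p by (subst prime_dvd_fact_iff) auto
      also have "fact (2 * m + 1) = fact m * fact (m + 1) * ((2 * m + 1) choose m)"
        using binomial_fact_lemma[of m "2 * m + 1"] by simp
      finally show "prime p \<and> p dvd ((2 * m + 1) choose m)"
        using p by (auto simp: prime_dvd_mult_iff prime_dvd_fact_iff simp del: fact_Suc)
    qed auto
    also have "(2 * m + 1) choose m \<le> (\<Sum>k\<le>m. (2 * m + 1) choose k)"
      by (rule member_le_sum) auto
    also have "\<dots> = 4 ^ m"
      by (simp only: binomial_r_part_sum power_mult) simp
    also have "4 ^ (m + 1) * 4 ^ m = (4 :: nat) ^ n"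
      using 4 by (simp add: power_add[symmetric])
    finally show ?thesis by simp
  qed
qed

lemma sum_ln_primes_le: "(\<Sum>p | prime p \<and> p \<le> n. ln (real p)) \<le> ln 4 * real n"
proof -
  have "(\<Sum>p | prime p \<and> p \<le> n. ln (real p)) = ln (real (\<Prod>{p. prime p \<and> p \<le> n}))"
    unfolding of_nat_prod by (subst ln_prod) (auto simp: prime_gt_0_nat)
  also have "\<dots> \<le> ln (real (4 ^ n))"
  proof (subst ln_le_cancel_iff)
    show "real (\<Prod>{p. prime p \<and> p \<le> n}) \<le> real (4 ^ n)"
      using primorial_le[of n] by (simp only: of_nat_le_iff)
  qed (auto simp: prime_gt_0_nat intro!: prod_pos)
  also have "\<dots> = ln 4 * real n" by (simp add: ln_realpow)
  finally show ?thesis .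
qed

section \<open>Weighted sums over primes by partial summation\<close>

lemma sum_primes_upto_Suc:
  fixes f :: "nat \<Rightarrow> real"
  shows "(\<Sum>p | prime p \<and> p \<le> Suc n. f p)
    = (\<Sum>p | prime p \<and> p \<le> n. f p) + (if prime (Suc n) then f (Suc n) else 0)"
proof (cases "prime (Suc n)")
  case True
  hence "{p. prime p \<and> p \<le> Suc n} = insert (Suc n) {p. prime p \<and> p \<le> n}"
    by (auto simp: le_Suc_eq)
  thus ?thesis using True by simp
next
  case False
  hence "{p. prime p \<and> p \<le> Suc n} = {p. prime p \<and> p \<le> n}"
    by (auto simp: le_Suc_eq)
  thus ?thesis using False by simp
qed

lemma sum_ln_primes_div_sqrt_le:
  "(\<Sum>p | prime p \<and> p \<le> n. ln (real p) / sqrt (real p)) \<le> 2 * ln 4 * sqrt (real n)"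
proof -
  define \<theta> where "\<theta> = (\<lambda>n. \<Sum>p | prime p \<and> p \<le> n. ln (real p))"
  define S where "S = (\<lambda>n. \<Sum>p | prime p \<and> p \<le> n. ln (real p) / sqrt (real p))"
  \<comment> \<open>Partial summation as an induction: the boundary term \<theta>(n) / sqrt n is
    kept so that the step closes, and starting at 1 keeps the square roots positive.\<close>
  have S_Suc: "S (Suc n) \<le> \<theta> (Suc n) / sqrt (real (Suc n)) + ln 4 * sqrt (real (Suc n))" for n
  proof (induction n)
    case 0
    have "\<not> (prime p \<and> p \<le> Suc 0)" for p using prime_ge_2_nat[of p] by auto
    hence "{p. prime p \<and> p \<le> Suc 0} = {}" by blast
    thus ?case by (simp only: S_def \<theta>_def sum.empty) simp
  next
    case (Suc n)
    define x y where "x = sqrt (real (Suc n))" and "y = sqrt (real (Suc (Suc n)))"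
    define l where "l = (if prime (Suc (Suc n)) then ln (real (Suc (Suc n))) else 0)"
    have xy: "x > 0" "y > 0" "x \<le> y" by (auto simp: x_def y_def)
    have S: "S (Suc (Suc n)) = S (Suc n) + l / y" "\<theta> (Suc (Suc n)) = \<theta> (Suc n) + l"
      by (simp_all only: S_def \<theta>_def l_def y_def sum_primes_upto_Suc[of _ "Suc n"]) auto
    have "\<theta> (Suc n) \<le> ln 4 * x\<^sup>2"
      unfolding \<theta>_def x_def using sum_ln_primes_le[of "Suc n"] by simp
    also have "\<dots> \<le> ln 4 * (x * y)"
      using xy by (auto simp: power2_eq_square intro!: mult_left_mono)
    finally have "\<theta> (Suc n) * (y - x) \<le> ln 4 * (x * y) * (y - x)"
      using xy by (intro mult_right_mono) auto
    hence "\<theta> (Suc n) / x \<le> \<theta> (Suc n) / y + ln 4 * (y - x)"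
      using xy by (simp add: field_simps)
    thus ?case using Suc.IH unfolding S x_def[symmetric] y_def[symmetric]
      by (simp add: add_divide_distrib right_diff_distrib)
  qed
  have "\<theta> n / sqrt (real n) \<le> ln 4 * sqrt (real n)" if "n > 0"
  proof -
    have "\<theta> n \<le> ln 4 * (sqrt (real n) * sqrt (real n))"
      using sum_ln_primes_le[of n] by (simp add: \<theta>_def)
    thus ?thesis using that by (intro mult_imp_div_pos_le) (simp, simp only: mult.assoc)
  qed
  moreover have "S n \<le> \<theta> n / sqrt (real n) + ln 4 * sqrt (real n)" if "n > 0"
    using S_Suc[of "n - 1"] that by (simp only: Suc_diff_1)
  ultimately have "S n \<le> 2 * ln 4 * sqrt (real n)" if "n > 0"
    using that by fastforce
  moreover have "{p::nat. prime p \<and> p \<le> 0} = {}" by auto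
  hence "S 0 = 0" by (simp only: S_def sum.empty)
  ultimately show ?thesis unfolding S_def by (cases "n = 0") auto
qed

text \<open>For primes above sqrt q, ln q is at most 2 ln p, so they reduce to the logarithmically
  weighted sum and contribute at most 8 sqrt q. The sum over the primes up to sqrt q is at most 4
  q^(1/4), and so is ln q; together they contribute 16 sqrt q.\<close>

lemma ln_mult_sum_primes_inverse_sqrt_le:
  assumes "q > 0"
  shows "ln (real q) * (\<Sum>p | prime p \<and> p \<le> q. 1 / sqrt (real p)) \<le> 24 * sqrt (real q)"
proof -
  define s where "s = floor_sqrt q"
  have s: "s\<^sup>2 \<le> q" "\<And>p. p\<^sup>2 \<le> q \<longleftrightarrow> p \<le> s" by (auto simp: s_def le_floor_sqrt_iff)
  have fin: "finite {p::nat. prime p \<and> p \<le> n}" for n by (rule finite_subset[of _ "{..n}"]) auto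
  have ln2: "ln (real p) \<ge> ln 2" if "prime p" for p
    using prime_ge_2_nat[OF that] by simp
  have ln4: "ln 4 = 2 * ln (2::real)" using ln_realpow[of 2 2] by simp
  have ln2': "ln 2 \<le> (1::real)" using ln_2_less_1 by simp
  have q: "ln (real q) \<ge> 0" using assms by simp
  define w where "w = real q powr (1/4)"
  have w: "w * w = sqrt (real q)"
    using assms by (simp add: w_def powr_add[symmetric] powr_half_sqrt)
  have w0: "w \<ge> 0" by (simp add: w_def)
  have "real s \<le> sqrt (real q)"
    using s(1) by (intro real_le_rsqrt) (simp only: of_nat_power[symmetric] of_nat_le_iff)
  hence "real s \<le> w\<^sup>2" using w by (simp add: power2_eq_square)
  hence sw: "sqrt (real s) \<le> w" using w0 by (rule real_le_lsqrt[rotated])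
  have lw: "ln (real q) \<le> 4 * w" using ln_powr_bound[of "real q" "1/4"] assms by (simp add: w_def)
  have small: "(\<Sum>p | prime p \<and> p \<le> s. 1 / sqrt (real p)) \<le> 4 * sqrt (real s)"
  proof -
    have "ln 2 * (\<Sum>p | prime p \<and> p \<le> s. 1 / sqrt (real p))
        \<le> (\<Sum>p | prime p \<and> p \<le> s. ln (real p) / sqrt (real p))"
      unfolding sum_distrib_left by (intro sum_mono) (auto intro!: divide_right_mono ln2)
    also have "\<dots> \<le> ln 2 * (4 * sqrt (real s))"
      using sum_ln_primes_div_sqrt_le[of s] ln4 by simp
    finally show ?thesis by simp
  qed
  have "(\<Sum>p | prime p \<and> p \<le> q. 1 / sqrt (real p))
      \<le> (\<Sum>p\<in>{p. prime p \<and> p \<le> s} \<union> {p. prime p \<and> p \<le> q \<and> \<not> p \<le> s}. 1 / sqrt (real p))"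
    using fin[of q] fin[of s] by (intro sum_mono2) auto
  also have "\<dots> = (\<Sum>p | prime p \<and> p \<le> s. 1 / sqrt (real p))
      + (\<Sum>p | prime p \<and> p \<le> q \<and> \<not> p \<le> s. 1 / sqrt (real p))"
    using fin[of q] fin[of s] by (intro sum.union_disjoint) auto
  finally have "ln (real q) * (\<Sum>p | prime p \<and> p \<le> q. 1 / sqrt (real p))
     \<le> ln (real q) * (\<Sum>p | prime p \<and> p \<le> s. 1 / sqrt (real p))
      + (\<Sum>p | prime p \<and> p \<le> q \<and> \<not> p \<le> s. ln (real q) * (1 / sqrt (real p)))"
    using q by (simp add: mult_left_mono distrib_left[symmetric] sum_distrib_left[symmetric] del: times_divide_eq_right)
  also have "ln (real q) * (\<Sum>p | prime p \<and> p \<le> s. 1 / sqrt (real p)) \<le> (4 * w) * (4 * w)"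
    using lw small sw q w0 by (intro mult_mono sum_nonneg) auto
  also have "(\<Sum>p | prime p \<and> p \<le> q \<and> \<not> p \<le> s. ln (real q) * (1 / sqrt (real p)))
      \<le> (\<Sum>p | prime p \<and> p \<le> q \<and> \<not> p \<le> s. 2 * (ln (real p) / sqrt (real p)))"
  proof (rule sum_mono)
    fix p assume "p \<in> {p. prime p \<and> p \<le> q \<and> \<not> p \<le> s}"
    hence p: "p > 0" "q < p\<^sup>2" using s(2)[of p] by (auto simp: prime_gt_0_nat)
    hence "ln (real q) \<le> ln (real (p\<^sup>2))" using assms by (subst ln_le_cancel_iff) auto
    also have "\<dots> = 2 * ln (real p)" using p by (simp add: ln_realpow)
    finally show "ln (real q) * (1 / sqrt (real p)) \<le> 2 * (ln (real p) / sqrt (real p))"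
      using p by (simp add: divide_right_mono)
  qed
  also have "\<dots> \<le> (\<Sum>p | prime p \<and> p \<le> q. 2 * (ln (real p) / sqrt (real p)))"
    using fin[of q] by (intro sum_mono2) (auto simp: prime_gt_0_nat Suc_le_eq)
  also have "\<dots> \<le> 8 * sqrt (real q)"
  proof -
    have "2 * ln 4 * sqrt (real q) \<le> 4 * sqrt (real q)"
      using ln4 ln2' by (intro mult_right_mono) auto
    thus ?thesis using sum_ln_primes_div_sqrt_le[of q] by (simp only: sum_distrib_left[symmetric])
  qed
  finally show ?thesis using w by simp
qed

text \<open>The recurrence of Leibniz's harmonic triangle, $1/D = 1/A - 1/B$, propagates divisibility.\<close>

lemma mult_binomial_dvd:
  fixes L n :: nat
  assumes L: "\<And>j. 0 < j \<Longrightarrow> j \<le> n \<Longrightarrow> j dvd L" and "0 < k" "k \<le> m" "m \<le> n"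
  shows "k * (m choose k) dvd L"
  using assms(2-)
proof (induction k arbitrary: m)
  case (Suc k)
  show ?case
  proof (cases "k = 0")
    case True
    thus ?thesis using Suc.prems L[of m] by simp
  next
    case False
    define A B D where "A = k * ((m - 1) choose k)" and "B = k * (m choose k)"
      and "D = Suc k * (m choose Suc k)"
    have "A dvd L" "B dvd L" using Suc.prems False by (auto simp: A_def B_def intro!: Suc.IH)
    then obtain u v where uv: "L = A * u" "L = B * v" by (metis dvdE)
    have pos: "A > 0" "B > 0" "D > 0" using False Suc.prems by (auto simp: A_def B_def D_def)
    have D1: "D = m * ((m - 1) choose k)" unfolding D_def by (rule binomial_absorption)
    have D2: "(m - k) * (m choose k) = m * ((m - 1) choose k)" by (rule binomial_absorb_comp)
    have "real k * real D = real m * real A"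
      unfolding D1 A_def by simp
    moreover have "real k * real D = (real m - real k) * real B"
      using arg_cong[OF D2, of real] Suc.prems unfolding D1 B_def by (simp add: of_nat_diff)
    \<comment> \<open>Multiplying the recurrence by L = A u = B v gives L = D (u - v); this runs
      over the reals and then the integers because subtraction of naturals truncates.\<close>
    ultimately have "real D * (real u - real v) = real L"
    proof -
      assume a: "real k * real D = real m * real A" and b: "real k * real D = (real m - real k) * real B"
      have mk: "real m > real k" "real k > 0" "real m > 0" using Suc.prems False by auto
      have "real k * (real D * (real u - real v)) = (real k * real D) * real u - (real k * real D) * real v"
        by (simp add: algebra_simps)
      also have "\<dots> = real m * (real A * real u) - (real m - real k) * (real B * real v)"
        by (subst a, subst b) (simp add: algebra_simps)
      also have "\<dots> = real k * real L"
        using arg_cong[OF uv(1), of real] arg_cong[OF uv(2), of real]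
        by (simp add: algebra_simps)
      finally show ?thesis using mk by simp
    qed
    hence "real_of_int (int D * (int u - int v)) = real_of_int (int L)" by simp
    hence "int D * (int u - int v) = int L" by (simp only: of_int_eq_iff)
    hence "int D dvd int L" by (metis dvd_triv_left)
    thus ?thesis unfolding D_def by (simp only: int_dvd_int_iff)
  qed
qed simp

text \<open>The least common multiple of 1, ..., n: each prime p \<le> n contributes its largest
  power up to n, hence a factor of at most n.\<close>

lemma common_multiple_le:
  obtains L :: nat where "L > 0" "\<And>j. 0 < j \<Longrightarrow> j \<le> n \<Longrightarrow> j dvd L"
    "L \<le> n ^ card {p. prime p \<and> p \<le> n}"
proof -
  define P where "P = {p::nat. prime p \<and> p \<le> n}"
  have P: "finite P" "\<And>p. p \<in> P \<Longrightarrow> prime p" by (auto simp: P_def)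
  define e where "e = (\<lambda>p::nat. GREATEST k. p ^ k \<le> n)"
  define L where "L = (\<Prod>p\<in>P. p ^ e p)"
  have bound: "k \<le> n" if "prime p" "p ^ k \<le> n" for p k :: nat
  proof -
    have "k < 2 ^ k" by (rule less_exp)
    also have "\<dots> \<le> p ^ k" using prime_ge_2_nat[OF that(1)] by (intro power_mono) auto
    finally show ?thesis using that by simp
  qed
  have e: "p ^ e p \<le> n" if "p \<in> P" for p
  proof -
    have "p ^ 1 \<le> n" using that by (simp add: P_def)
    thus ?thesis unfolding e_def
      by (rule GreatestI_nat[of "\<lambda>k. p ^ k \<le> n" 1 n]) (use bound[of p] P(2)[OF that] in auto)
  qed
  have e': "k \<le> e p" if "p \<in> P" "p ^ k \<le> n" for p k
    unfolding e_def by (rule Greatest_le_nat[of "\<lambda>k. p ^ k \<le> n" k n])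
      (use bound[of p] P(2)[OF that(1)] that in auto)
  show ?thesis
  proof (rule that[of L])
    show L: "L > 0" unfolding L_def using P(2) by (intro prod_pos) (auto simp: prime_gt_0_nat)
    show "L \<le> n ^ card {p. prime p \<and> p \<le> n}"
      unfolding L_def P_def[symmetric] using prod_mono[of P "\<lambda>p. p ^ e p" "\<lambda>_. n"] e by simp
    fix j assume j: "0 < j" "j \<le> n"
    show "j dvd L"
    proof (rule multiplicity_le_imp_dvd)
      fix p :: nat assume p: "prime p"
      have dvd: "p ^ multiplicity p j dvd j" by (rule multiplicity_dvd)
      hence le: "p ^ multiplicity p j \<le> n" using j by (metis dvd_imp_le order_trans)
      show "multiplicity p j \<le> multiplicity p L"
      proof (cases "p \<in> P")
        case True
        thus ?thesis using e'[OF True le] P p by (simp add: L_def multiplicity_prod_prime_powers)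
      next
        case False
        hence "\<not> p dvd j" using p j by (auto simp: P_def dest: dvd_imp_le)
        thus ?thesis by (simp add: not_dvd_imp_multiplicity_0)
      qed
    qed (use j in auto)
  qed
qed

text \<open>Nair's method: m times the central binomial coefficient of 2m divides a common multiple
  of 1, ..., 2m that is at most 2m to the power \<pi>(2m), while it is itself at least 4^m /
  2.\<close>

lemma prime_count_ge:
  fixes y :: real
  assumes "y \<ge> 2"
  shows "real (card {p::nat. prime p \<and> real p \<le> y}) * ln y \<ge> ln 2 / 4 * y"
proof -
  define m where "m = nat \<lfloor>y / 2\<rfloor>"
  have m: "m \<ge> 1" "real (2 * m) \<le> y" "real (2 * m) > y - 2"
    using assms unfolding m_def by linarith+
  define k where "k = card {p::nat. prime p \<and> p \<le> 2 * m}"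
  obtain L :: nat where L: "L > 0" "\<And>j. 0 < j \<Longrightarrow> j \<le> 2 * m \<Longrightarrow> j dvd L" "L \<le> (2 * m) ^ k"
    using common_multiple_le[of "2 * m"] unfolding k_def by blast
  have "m * ((2 * m) choose m) dvd L" using m by (intro mult_binomial_dvd[OF L(2)]) auto
  hence "m * ((2 * m) choose m) \<le> (2 * m) ^ k" using L dvd_imp_le order_trans by blast
  hence "real (m * ((2 * m) choose m)) \<le> real ((2 * m) ^ k)" by (simp only: of_nat_le_iff)
  moreover have "4 ^ m / 2 \<le> real (m * ((2 * m) choose m))"
    using central_binomial_lower_bound[of m] m by (simp add: field_simps)
  ultimately have "4 ^ m / 2 \<le> real (2 * m) ^ k" by simp
  hence "ln (4 ^ m / 2) \<le> ln (real (2 * m) ^ k)" using m by (subst ln_le_cancel_iff) auto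
  also have "\<dots> = real k * ln (real (2 * m))" using m by (subst ln_realpow) auto
  also have "\<dots> \<le> real k * ln y"
    using m by (intro mult_left_mono) (auto simp: ln_le_cancel_iff simp del: of_nat_mult)
  also have "real k \<le> real (card {p::nat. prime p \<and> real p \<le> y})"
  proof -
    have "{p::nat. prime p \<and> real p \<le> y} \<subseteq> {..nat \<lfloor>y\<rfloor>}" by (auto simp: le_nat_floor)
    hence "finite {p::nat. prime p \<and> real p \<le> y}" using finite_subset by blast
    moreover have "{p::nat. prime p \<and> p \<le> 2 * m} \<subseteq> {p. prime p \<and> real p \<le> y}"
    proof safe
      fix p :: nat assume "p \<le> 2 * m"
      hence "real p \<le> real (2 * m)" by (simp only: of_nat_le_iff)
      thus "real p \<le> y" using m by simp
    qed
    ultimately show ?thesis unfolding k_def by (simp add: card_mono)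
  qed
  finally have "ln (4 ^ m / 2) \<le> real (card {p::nat. prime p \<and> real p \<le> y}) * ln y"
    using assms by (simp add: mult_right_mono)
  moreover have "ln (4 ^ m / 2) = ln 2 * (2 * real m - 1)"
  proof -
    have "(4::real) ^ m = 2 ^ (2 * m)" by (simp add: power_mult)
    thus ?thesis by (simp add: ln_div ln_realpow algebra_simps)
  qed
  \<comment> \<open>For \<open>y \<le> 4\<close> this rests on \<open>m \<ge> 1\<close>, for larger
    \<open>y\<close> on \<open>2 * m > y - 2\<close>.\<close>
  moreover have "ln 2 * (y / 4) \<le> ln 2 * (2 * real m - 1)"
  proof (rule mult_left_mono)
    show "y / 4 \<le> 2 * real m - 1" using m by simp
  qed simp
  ultimately have "ln 2 * (y / 4) \<le> real (card {p::nat. prime p \<and> real p \<le> y}) * ln y"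
    by linarith
  thus ?thesis by simp
qed

section \<open>Weighted estimates for homogeneous Dirichlet polynomials\<close>

text \<open>At 1 the value is 0, but the exponent \<open>Omega 1\<close> is 0 as well, so the
  coefficient at n = 1 gets the factor \<open>0 ^ 0 = 1\<close>.\<close>

definition bohr_weight :: "real \<Rightarrow> real" where
  "bohr_weight x = ln x powr (1/4) / x powr (1/8)"

lemma bohr_weight_nonneg: "bohr_weight x \<ge> 0"
  by (simp add: bohr_weight_def)

lemma bohr_weight_power4:
  assumes "x \<ge> 1"
  shows "bohr_weight x ^ 4 = ln x / sqrt x"
proof -
  have "(ln x powr (1/4)) ^ 4 = ln x"
    using assms by (simp add: powr_realpow'[symmetric] powr_powr)
  moreover have "(x powr (1/8)) ^ 4 = sqrt x"
    using assms by (simp add: powr_realpow'[symmetric] powr_powr powr_half_sqrt)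
  ultimately show ?thesis by (simp add: bohr_weight_def power_divide)
qed

text \<open>The logarithm is traded for x^(1/120), and 1/120 - 1/8 = -7/60; the remaining decay
  still suffices in every degree except 2.\<close>

lemma bohr_weight_le:
  assumes "x \<ge> 1"
  shows "bohr_weight x \<le> 3 * x powr (-7/60)"
proof -
  have "ln x \<le> 30 * x powr (1/30)" using ln_powr_bound[of x "1/30"] assms by simp
  \<comment> \<open>The constant 30 is raised to 81 so that its fourth root is 3.\<close>
  also have "\<dots> \<le> 81 * x powr (1/30)" by (intro mult_right_mono) auto
  finally have "ln x powr (1/4) \<le> (81 * x powr (1/30)) powr (1/4)"
    using assms by (intro powr_mono2) auto
  also have "\<dots> = 3 * x powr (1/120)"
  proof -
    have "(81::real) powr (1/4) = (3 powr 4) powr (1/4)" by simp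
    also have "\<dots> = 3" by (simp only: powr_powr) simp
    finally show ?thesis by (simp add: powr_mult powr_powr)
  qed
  finally have "bohr_weight x \<le> 3 * x powr (1/120) / x powr (1/8)"
    unfolding bohr_weight_def by (intro divide_right_mono) auto
  also have "\<dots> = 3 * x powr (1/120 - 1/8)" using assms by (simp only: powr_diff times_divide_eq_right)
  finally show ?thesis by simp
qed

lemma bohr_weight_power_sq_le:
  assumes "x \<ge> 1"
  shows "(bohr_weight x ^ m)\<^sup>2 \<le> 9 ^ m * x powr (- 7 * real m / 30)"
proof -
  have "bohr_weight x ^ (m * 2) \<le> (3 * x powr (-7/60)) ^ (m * 2)"
    by (intro power_mono bohr_weight_le bohr_weight_nonneg assms)
  also have "\<dots> = 9 ^ m * x powr (- 7 * real m / 30)"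
  proof -
    have "(3::real) ^ (m * 2) = 9 ^ m" by (simp add: power_mult mult.commute[of m])
    moreover have "(x powr (-7/60)) ^ (m * 2) = x powr (- 7 * real m / 30)"
      using assms by (simp add: powr_realpow[symmetric] powr_powr)
    ultimately show ?thesis by (simp only: power_mult_distrib)
  qed
  finally show ?thesis by (simp only: power_mult)
qed

text \<open>The value zeta(21/20), the term at 0 being 0. The exponent comes from degree 3, which
  leaves the slowest decay of all degrees where this series is needed.\<close>

definition zeta_const :: real where
  "zeta_const = (\<Sum>n. real n powr (-21/20))"

lemma sum_powr_le_zeta_const: "finite A \<Longrightarrow> (\<Sum>n\<in>A. real n powr (-21/20)) \<le> zeta_const"
  unfolding zeta_const_def
  by (intro sum_le_suminf) (auto simp: summable_real_powr_iff)

lemma zeta_const_nonneg: "zeta_const \<ge> 0"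
  using sum_powr_le_zeta_const[of "{}"] by simp

lemma homogeneous_weighted_sum_le_high:
  assumes A: "A \<subseteq> {1..N}" and bd: "torus_bounded A a B" and m: "m \<ge> 5"
  shows "(\<Sum>n\<in>A. norm (a n) * bohr_weight (real n) ^ m) \<le> (3 * (1 + zeta_const)) ^ m * B"
proof -
  have fA: "finite A" using finite_subset[OF A] by simp
  have B: "B \<ge> 0" using bd torus_bounded_nonneg by blast
  have "(\<Sum>n\<in>A. (bohr_weight (real n) ^ m)\<^sup>2) \<le> (\<Sum>n\<in>A. 9 ^ m * real n powr (-21/20))"
  proof (rule sum_mono)
    fix n assume "n \<in> A"
    hence n: "real n \<ge> 1" using A by auto
    have "(bohr_weight (real n) ^ m)\<^sup>2 \<le> 9 ^ m * real n powr (- 7 * real m / 30)"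
      by (rule bohr_weight_power_sq_le[OF n])
    also have "\<dots> \<le> 9 ^ m * real n powr (-21/20)"
      using n m by (intro mult_left_mono powr_mono) auto
    finally show "(bohr_weight (real n) ^ m)\<^sup>2 \<le> 9 ^ m * real n powr (-21/20)" .
  qed
  also have "\<dots> \<le> 9 ^ m * zeta_const"
    unfolding sum_distrib_left[symmetric] by (intro mult_left_mono sum_powr_le_zeta_const fA) auto
  finally have "sqrt (\<Sum>n\<in>A. (bohr_weight (real n) ^ m)\<^sup>2) \<le> sqrt (9 ^ m * zeta_const)"
    by (rule real_sqrt_le_mono)
  also have "\<dots> = 3 ^ m * sqrt zeta_const"
  proof -
    have "sqrt (9 ^ m) = 3 ^ m" by (simp add: real_sqrt_power)
    thus ?thesis by (simp add: real_sqrt_mult)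
  qed
  \<comment> \<open>The fixed factor is absorbed into the base because a bound of the form K^m B is
    wanted.\<close>
  also have "\<dots> \<le> 3 ^ m * (1 + zeta_const) ^ m"
  proof (rule mult_left_mono)
    have "sqrt zeta_const \<le> 1 + zeta_const"
      using zeta_const_nonneg by (intro real_le_lsqrt) (auto simp: power2_eq_square algebra_simps)
    also have "\<dots> \<le> (1 + zeta_const) ^ m"
      using zeta_const_nonneg m by (intro self_le_power) auto
    finally show "sqrt zeta_const \<le> (1 + zeta_const) ^ m" .
  qed simp
  finally have S: "sqrt (\<Sum>n\<in>A. (bohr_weight (real n) ^ m)\<^sup>2) \<le> (3 * (1 + zeta_const)) ^ m"
    by (simp only: power_mult_distrib)
  have "(\<Sum>n\<in>A. norm (a n) * bohr_weight (real n) ^ m)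
      \<le> sqrt (\<Sum>n\<in>A. (norm (a n))\<^sup>2) * sqrt (\<Sum>n\<in>A. (bohr_weight (real n) ^ m)\<^sup>2)"
    using L2_set_mult_ineq[of "\<lambda>n. norm (a n)" "\<lambda>n. bohr_weight (real n) ^ m" A]
    by (simp add: L2_set_def bohr_weight_nonneg)
  also have "\<dots> \<le> B * (3 * (1 + zeta_const)) ^ m"
    using B by (intro mult_mono torus_bounded_L2[OF A bd] S) (auto intro!: sum_nonneg)
  finally show ?thesis by (simp add: mult.commute)
qed

section \<open>Splitting off the largest prime factor\<close>

lemma le_power_Omega:
  assumes "k > 0" "\<And>p. p \<in> prime_factors k \<Longrightarrow> p \<le> q"
  shows "k \<le> q ^ Omega k"
proof -
  have "(\<And>p. p \<in># M \<Longrightarrow> p \<le> q) \<Longrightarrow> prod_mset M \<le> q ^ size M" for M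
    by (induction M) (auto intro!: mult_mono)
  from this[of "prime_factorization k"] show ?thesis
    using assms by (simp add: Omega_def prod_mset_prime_factorization_nat)
qed

lemma largest_prime_factorE:
  assumes "n \<ge> 2"
  obtains q k where "prime q" "Max (prime_factors n) = q" "n = q * k" "k > 0"
    "k \<le> q ^ Omega k" "Omega n = Suc (Omega k)" "\<And>p. p \<in> prime_factors k \<Longrightarrow> p \<le> q"
proof -
  define q where "q = Max (prime_factors n)"
  have "n \<noteq> 0" "n \<noteq> 1" using assms by auto
  hence "prime_factors n \<noteq> {}" by (auto simp: prime_factorization_empty_iff)
  hence "q \<in> prime_factors n" unfolding q_def by (intro Max_in) auto
  hence q: "prime q" "q dvd n" by (auto simp: in_prime_factors_iff)
  then obtain k where k: "n = q * k" by (elim dvdE)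
  have k0: "k > 0" "q > 0" using k assms by (auto intro: Nat.gr0I)
  have le: "p \<le> q" if "p \<in> prime_factors k" for p
    unfolding q_def using that k \<open>n \<noteq> 0\<close> by (intro Max_ge) (auto simp: in_prime_factors_iff)
  have Max: "Max (prime_factors n) = q" by (simp add: q_def)
  have Om: "Omega n = Suc (Omega k)"
    using k0 q by (simp add: k Omega_mult) (simp add: Omega_def[of q] prime_factorization_prime)
  show ?thesis
    by (rule that[OF q(1) Max k k0(1) le_power_Omega[OF k0(1) le] Om le])
qed

text \<open>The sum over all $n$ with prescribed largest prime factor $q$ stays bounded uniformly
  in $q$; only for $m = 2$ is the density of the primes needed.\<close>

lemma largest_prime_sum_le:
  assumes A: "A \<subseteq> {2..N}" and deg: "\<And>n. n \<in> A \<Longrightarrow> Omega n = m" and m: "m \<in> {1, 2, 3, 4}"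
    and q: "prime q"
  shows "(\<Sum>n | n \<in> A \<and> Max (prime_factors n) = q. (bohr_weight (real n) ^ m)\<^sup>2)
           \<le> 9 ^ 4 * (1 + zeta_const)"
proof -
  define E where "E = {n \<in> A. Max (prime_factors n) = q}"
  have fE: "finite E" using finite_subset[OF A] by (simp add: E_def)
  have q0: "q > 0" using q by (rule prime_gt_0_nat)
  have E: "\<exists>k>0. n = q * k \<and> k \<le> q ^ (m - 1) \<and> Omega k = m - 1 \<and> (\<forall>p\<in>prime_factors k. p \<le> q)"
    if "n \<in> E" for n
  proof -
    have "n \<ge> 2" using that A by (auto simp: E_def)
    thus ?thesis
    proof (rule largest_prime_factorE)
      fix q' k assume *: "Max (prime_factors n) = q'" "n = q' * k" "k > 0"
        "k \<le> q' ^ Omega k" "Omega n = Suc (Omega k)" "\<And>p. p \<in> prime_factors k \<Longrightarrow> p \<le> q'"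
      have "q' = q" "Omega n = m" using that deg *(1) by (auto simp: E_def)
      thus ?thesis using * by auto
    qed
  qed
  have inj: "inj_on (\<lambda>n. n div q) E"
    using E q0 by (intro inj_onI) (metis nonzero_mult_div_cancel_left less_not_refl2)
  show ?thesis
  proof (cases "m = 2")
    case True
    \<comment> \<open>Here n = q k with k a prime up to q, so ln n \<le> 2 ln q. What remains is the
      sum of 1 / sqrt k over primes, whose Chebyshev bound cancels the factor ln q / sqrt q.\<close>
    have "(\<Sum>n\<in>E. (bohr_weight (real n) ^ m)\<^sup>2)
        \<le> (\<Sum>n\<in>E. 2 * ln (real q) / sqrt (real q) * (1 / sqrt (real (n div q))))"
    proof (rule sum_mono)
      fix n assume "n \<in> E"
      then obtain k where k: "k > 0" "n = q * k" "k \<le> q" using E[of n] True by auto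
      have "n \<in> {2..N}" using \<open>n \<in> E\<close> A unfolding E_def by blast
      hence n: "real n \<ge> 1" by simp
      have n': "real n = real q * real k" using k by simp
      have "(bohr_weight (real n) ^ m)\<^sup>2 = bohr_weight (real n) ^ 4"
        by (simp add: True power_mult[symmetric])
      also have "\<dots> = (ln (real q) + ln (real k)) / sqrt (real n)"
        unfolding bohr_weight_power4[OF n] using k(1) q0 by (simp add: n' ln_mult)
      also have "\<dots> \<le> (ln (real q) + ln (real q)) / sqrt (real n)"
        using k q0 by (intro divide_right_mono add_left_mono) auto
      finally show "(bohr_weight (real n) ^ m)\<^sup>2
          \<le> 2 * ln (real q) / sqrt (real q) * (1 / sqrt (real (n div q)))"
        using k q0 by (simp add: real_sqrt_mult)
    qed
    also have "\<dots> = 2 * ln (real q) / sqrt (real q) * (\<Sum>k\<in>(\<lambda>n. n div q) ` E. 1 / sqrt (real k))"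
      by (simp only: sum_distrib_left[symmetric] sum.reindex[OF inj] o_def)
    also have "\<dots> \<le> 2 * ln (real q) / sqrt (real q) * (\<Sum>p | prime p \<and> p \<le> q. 1 / sqrt (real p))"
    proof (intro mult_left_mono sum_mono2)
      show "(\<lambda>n. n div q) ` E \<subseteq> {p. prime p \<and> p \<le> q}"
      proof safe
        fix n assume "n \<in> E"
        then obtain k where k: "k > 0" "n = q * k" "Omega k = 1" "k \<le> q" using E[of n] True by auto
        then obtain p where p: "prime_factorization k = {#p#}"
          using size_1_singleton_mset unfolding Omega_def by metis
        have "p \<in># prime_factorization k" by (simp add: p)
        hence "prime p" by (rule in_prime_factors_imp_prime)
        moreover have "k = p" using k(1) p prod_mset_prime_factorization_nat[of k] by simp
        ultimately have "prime k" by simp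
        thus "prime (n div q)" "n div q \<le> q" using k q0 by auto
      qed
    qed (use q0 in auto)
    also have "\<dots> = 2 / sqrt (real q) * (ln (real q) * (\<Sum>p | prime p \<and> p \<le> q. 1 / sqrt (real p)))"
      by (simp add: field_simps)
    also have "\<dots> \<le> 2 / sqrt (real q) * (24 * sqrt (real q))"
      by (intro mult_left_mono ln_mult_sum_primes_inverse_sqrt_le q0) auto
    also have "\<dots> = 48" using q0 by simp
    also have "\<dots> \<le> 9 ^ 4 * (1 + zeta_const)" using zeta_const_nonneg by simp
    finally show ?thesis by (simp add: E_def)
  next
    case False
    have "(\<Sum>n\<in>E. (bohr_weight (real n) ^ m)\<^sup>2) \<le> (\<Sum>n\<in>E. 9 ^ 4 * real (n div q) powr (-21/20))"
    proof (rule sum_mono)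
      fix n assume "n \<in> E"
      then obtain k where k: "k > 0" "n = q * k" "k \<le> q ^ (m - 1)" using E[of n] by auto
      have k1: "real k \<ge> 1" and q1: "real q \<ge> 1" using k q0 by auto
      have "(bohr_weight (real n) ^ m)\<^sup>2 \<le> 9 ^ m * real n powr (- 7 * real m / 30)"
      proof (rule bohr_weight_power_sq_le)
        have "n \<in> {2..N}" using \<open>n \<in> E\<close> A unfolding E_def by blast
        thus "real n \<ge> 1" by simp
      qed
      also have "\<dots> \<le> 9 ^ 4 * real n powr (- 7 * real m / 30)"
        using m by (intro mult_right_mono power_increasing) auto
      also have "real n powr (- 7 * real m / 30) \<le> real k powr (-21/20)"
      proof (cases "m = 1")
        case True
        hence "k = 1" using k by simp
        thus ?thesis using k1 q1 k powr_mono[of "- 7 * real m / 30" 0 "real n"] by simp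
      next
        case m1: False
        hence m34: "m = 3 \<or> m = 4" using m False by auto
        \<comment> \<open>As q \<ge> k^(1/(m - 1)), decay in q becomes decay in k, with total
          exponent 7m^2 / (30(m - 1)): 21/20 for m = 3 and 56/45 for m = 4, but only 14/15 for m =
          2, whence the separate case.\<close>
        have "real k powr (1 / real (m - 1)) \<le> (real q ^ (m - 1)) powr (1 / real (m - 1))"
          using k by (intro powr_mono2) (auto simp flip: of_nat_power)
        also have "\<dots> = real q"
          using m34 q0 by (auto simp: powr_realpow[symmetric] powr_powr)
        finally have kq: "real k powr (1 / real (m - 1)) \<le> real q" .
        have "real n powr (- 7 * real m / 30) = real k powr (- 7 * real m / 30) * real q powr (- 7 * real m / 30)"
          using k by (simp add: powr_mult)
        also have "\<dots> \<le> real k powr (- 7 * real m / 30) * (real k powr (1 / real (m - 1))) powr (- 7 * real m / 30)"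
          using kq k by (intro mult_left_mono powr_mono2') auto
        also have "\<dots> = real k powr (- 7 * real m / 30 + - 7 * real m / 30 * (1 / real (m - 1)))"
          using k by (simp add: powr_powr powr_add[symmetric] mult.commute)
        also have "\<dots> \<le> real k powr (-21/20)"
          using k1 m34 by (intro powr_mono) auto
        finally show ?thesis .
      qed
      finally show "(bohr_weight (real n) ^ m)\<^sup>2 \<le> 9 ^ 4 * real (n div q) powr (-21/20)"
        using k q0 by simp
    qed
    also have "\<dots> = 9 ^ 4 * (\<Sum>k\<in>(\<lambda>n. n div q) ` E. real k powr (-21/20))"
      by (simp only: sum_distrib_left[symmetric] sum.reindex[OF inj] o_def)
    also have "\<dots> \<le> 9 ^ 4 * (1 + zeta_const)"
      using sum_powr_le_zeta_const[of "(\<lambda>n. n div q) ` E"] fE by simp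
    finally show ?thesis by (simp add: E_def)
  qed
qed

lemma homogeneous_weighted_sum_le:
  "\<exists>K\<ge>1. \<forall>N A a m B. A \<subseteq> {2..N} \<longrightarrow> (\<forall>n\<in>A. Omega n = m) \<longrightarrow> m \<ge> 1 \<longrightarrow> torus_bounded A a B \<longrightarrow>
     (\<Sum>n\<in>A. norm (a n) * bohr_weight (real n) ^ m) \<le> K ^ m * B"
proof -
  define G where "G = 9 ^ 4 * (1 + zeta_const)"
  define C where "C = sqrt G * (12 * 2 ^ 4 * 4\<^sup>2)"
  define K where "K = max C (3 * (1 + zeta_const))"
  have "G \<ge> 1" using zeta_const_nonneg by (simp add: G_def)
  hence G1: "sqrt G \<ge> 1" by simp
  have "C = 3072 * sqrt G" by (simp add: C_def)
  hence C1: "C \<ge> 1" using G1 by linarith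
  show ?thesis
  proof (intro exI[of _ K] conjI allI impI)
    show "K \<ge> 1" using C1 by (simp add: K_def)
    fix N A a m B
    assume *: "A \<subseteq> {2..N}" "\<forall>n\<in>A. Omega n = m" "m \<ge> 1" "torus_bounded A a B"
    have B: "B \<ge> 0" using * torus_bounded_nonneg by blast
    show "(\<Sum>n\<in>A. norm (a n) * bohr_weight (real n) ^ m) \<le> K ^ m * B"
    proof (cases "m \<ge> 5")
      case True
      have "A \<subseteq> {1..N}" using * by auto
      from homogeneous_weighted_sum_le_high[OF this *(4) True]
      have "(\<Sum>n\<in>A. norm (a n) * bohr_weight (real n) ^ m) \<le> (3 * (1 + zeta_const)) ^ m * B" .
      also have "\<dots> \<le> K ^ m * B"
        using B zeta_const_nonneg by (intro mult_right_mono power_mono) (auto simp: K_def)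
      finally show ?thesis .
    next
      case False
      hence m: "m \<in> {1, 2, 3, 4}" using * by auto
      have "(\<Sum>n\<in>A. norm (a n) * bohr_weight (real n) ^ m) \<le> sqrt G * (12 * 2 ^ m * real (m\<^sup>2) * B)"
        using * unfolding G_def
        by (intro weighted_sum_le[OF *(1,4)] largest_prime_sum_le[OF *(1) _ m]) auto
      also have "\<dots> \<le> sqrt G * (12 * 2 ^ 4 * 4\<^sup>2 * B)"
        using m B G1 by (intro mult_left_mono mult_right_mono mult_mono) auto
      also have "\<dots> = C * B" by (simp add: C_def)
      also have "\<dots> \<le> K ^ m * B"
      proof (rule mult_right_mono[OF _ B])
        have "C \<le> C ^ m" using C1 * by (intro self_le_power) auto
        also have "\<dots> \<le> K ^ m" using C1 by (intro power_mono) (auto simp: K_def)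
        finally show "C \<le> K ^ m" .
      qed
      finally show ?thesis .
    qed
  qed
qed

section \<open>The Bohr inequality\<close>

lemma Omega_1 [simp]: "Omega (Suc 0) = 0"
  by (simp add: Omega_def)

lemma Omega_eq_0_iff: "n > 0 \<Longrightarrow> Omega n = 0 \<longleftrightarrow> n = 1"
  by (simp add: Omega_def prime_factorization_empty_iff)

lemma Omega_level_0:
  assumes "0 \<notin> X" "1 \<in> X"
  shows "{n \<in> X. Omega n = 0} = {1}"
proof -
  have "n \<in> X \<and> Omega n = 0 \<longleftrightarrow> n = 1" for n
    using assms Omega_eq_0_iff[of n] by (cases "n = 0") auto
  thus ?thesis by (simp add: set_eq_iff)
qed

text \<open>Rotating all variables by a common \<open>u\<close> grades the polynomial by
  \<open>Omega\<close>, with constant term \<open>a 1\<close>, so Caratheodory's inequality in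
  \<open>u\<close> applies. Keeping B - |a_1| instead of B lets the final sum close at exactly
  B.\<close>

lemma torus_bounded_homogeneous_part:
  assumes "finite X" "0 \<notin> X" "1 \<in> X" "torus_bounded X a B" "m > 0"
  shows "torus_bounded {n \<in> X. Omega n = m} a (2 * (B - norm (a 1)))"
  unfolding torus_bounded_def
proof (intro allI impI)
  fix z :: "nat \<Rightarrow> complex" assume z: "\<forall>p. norm (z p) = 1"
  have "norm (\<Sum>n | n \<in> X \<and> Omega n = 0. a n * chi z n) = norm (a 1)"
    by (simp add: Omega_level_0[OF assms(2,3)])
  moreover have "norm (\<Sum>n\<in>X. a n * chi z n * u ^ Omega n) \<le> B" if "norm u = 1" for u
    using torus_boundedD[OF assms(4), of "\<lambda>p. u * z p"] that z
    by (simp add: chi_times chi_const norm_mult mult_ac)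
  ultimately show "norm (\<Sum>n\<in>{n \<in> X. Omega n = m}. a n * chi z n) \<le> 2 * (B - norm (a 1))"
    using norm_coeff_le_Caratheodory[OF assms(1,5), of "\<lambda>n. a n * chi z n" Omega B] by simp
qed

lemma sum_third_powers: "(\<Sum>m\<in>{1..D}. (1/3) ^ m) \<le> (1/2 :: real)"
proof -
  have "(\<Sum>m\<in>{1..D}. (1/3) ^ m) = (1 - (1/3) ^ D) / (2 :: real)"
  proof (induction D)
    case (Suc D)
    have *: "(1 - t) / 2 + t / 3 = (1 - t / 3) / 2" for t :: real by (simp add: field_simps)
    have "(\<Sum>m\<in>{1..Suc D}. (1/3) ^ m) = (\<Sum>m\<in>{1..D}. (1/3) ^ m) + (1/3 :: real) ^ D / 3" by simp
    also have "\<dots> = (1 - (1/3) ^ D) / 2 + (1/3) ^ D / 3" by (simp only: Suc.IH)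
    also have "\<dots> = (1 - (1/3) ^ D / 3) / 2" by (rule *)
    finally show ?case by simp
  qed simp
  thus ?thesis by simp
qed

lemma Bohr_inequality:
  "\<exists>C>0. \<forall>N X a B. X \<subseteq> {1..N} \<longrightarrow> 1 \<in> X \<longrightarrow> torus_bounded X a B \<longrightarrow>
     (\<Sum>n\<in>X. norm (a n) * (C * bohr_weight (real n)) ^ Omega n) \<le> B"
proof -
  obtain K where K: "K \<ge> 1" and hom: "\<And>N A a m B. A \<subseteq> {2..N} \<Longrightarrow> (\<forall>n\<in>A. Omega n = m) \<Longrightarrow> m \<ge> 1
      \<Longrightarrow> torus_bounded A a B \<Longrightarrow> (\<Sum>n\<in>A. norm (a n) * bohr_weight (real n) ^ m) \<le> K ^ m * B"
    using homogeneous_weighted_sum_le by blast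
  \<comment> \<open>As in Bohr's theorem on power series: the sum of 3^(-m) over m \<ge> 1 is 1/2,
    which cancels the 2 of Caratheodory's inequality.\<close>
  define C where "C = 1 / (3 * K)"
  have "C > 0" using K by (simp add: C_def)
  moreover have "(\<Sum>n\<in>X. norm (a n) * (C * bohr_weight (real n)) ^ Omega n) \<le> B"
    if X: "X \<subseteq> {1..N}" "1 \<in> X" and bd: "torus_bounded X a B" for N X a B
  proof -
    have fX: "finite X" "0 \<notin> X" using finite_subset[OF X(1)] X by auto
    define D where "D = Max (Omega ` X)"
    define T where "T = (\<lambda>m. \<Sum>n | n \<in> X \<and> Omega n = m. norm (a n) * (C * bohr_weight (real n)) ^ Omega n)"
    have D: "Omega ` X \<subseteq> {0..D}" using fX by (auto simp: D_def)
    have "norm (a 1) \<le> B"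
    proof -
      \<comment> \<open>Even an empty part of degree 1 yields the claim, since every bound on the
        torus is nonnegative.\<close>
      have "torus_bounded {n \<in> X. Omega n = 1} a (2 * (B - norm (a 1)))"
        by (rule torus_bounded_homogeneous_part[OF fX X(2) bd]) simp
      thus ?thesis using torus_bounded_nonneg by fastforce
    qed
    have T: "T m \<le> (1/3) ^ m * (2 * (B - norm (a 1)))" if m: "m \<ge> 1" for m
    proof -
      let ?A = "{n \<in> X. Omega n = m}"
      have A: "?A \<subseteq> {2..N}"
      proof
        fix n assume "n \<in> ?A"
        hence "n \<in> {1..N}" "n \<noteq> 1" using X m Omega_eq_0_iff[of n] by (auto simp: Omega_def)
        thus "n \<in> {2..N}" by auto
      qed
      have "T m = C ^ m * (\<Sum>n\<in>?A. norm (a n) * bohr_weight (real n) ^ m)"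
        by (simp add: T_def sum_distrib_left power_mult_distrib mult_ac)
      also have "\<dots> \<le> C ^ m * (K ^ m * (2 * (B - norm (a 1))))"
        using m \<open>C > 0\<close> fX X(2) bd
        by (intro mult_left_mono hom[OF A] torus_bounded_homogeneous_part) auto
      also have "\<dots> = (C * K) ^ m * (2 * (B - norm (a 1)))"
        by (simp add: power_mult_distrib)
      also have "C * K = 1/3" using K by (simp add: C_def)
      finally show ?thesis .
    qed
    have "(\<Sum>n\<in>X. norm (a n) * (C * bohr_weight (real n)) ^ Omega n) = (\<Sum>m\<in>{0..D}. T m)"
      unfolding T_def using fX D by (intro sum.group[symmetric]) auto
    also have "\<dots> = T 0 + (\<Sum>m\<in>{1..D}. T m)"
      by (simp add: sum.atLeast_Suc_atMost)
    also have "T 0 = norm (a 1)" unfolding T_def by (simp add: Omega_level_0[OF fX(2) X(2)])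
    also have "(\<Sum>m\<in>{1..D}. T m) \<le> (\<Sum>m\<in>{1..D}. (1/3) ^ m * (2 * (B - norm (a 1))))"
      by (intro sum_mono T) auto
    also have "\<dots> \<le> 1/2 * (2 * (B - norm (a 1)))"
      unfolding sum_distrib_right[symmetric] using \<open>norm (a 1) \<le> B\<close>
      by (intro mult_right_mono sum_third_powers) auto
    also have "norm (a 1) + 1/2 * (2 * (B - norm (a 1))) = B" by (simp add: field_simps)
    finally show ?thesis by simp
  qed
  ultimately show ?thesis by blast
qed

section \<open>The upper bound\<close>

text \<open>The discrete Fourier matrix is sqrt M times a unitary matrix.\<close>

lemma root_of_unity_Parseval:
  "(\<Sum>i<M. (norm (\<Sum>j<M. c j * root_of_unity M i ^ j))\<^sup>2) = real M * (\<Sum>j<M. (norm (c j))\<^sup>2)"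
proof -
  have "complex_of_real (\<Sum>i<M. (norm (\<Sum>j<M. c j * root_of_unity M i ^ j))\<^sup>2)
      = (\<Sum>i<M. \<Sum>j<M. \<Sum>k<M. c j * cnj (c k) * (root_of_unity M i ^ j * cnj (root_of_unity M i ^ k)))"
    by (simp add: complex_norm_square sum_product mult_ac del: of_real_power)
  also have "\<dots> = (\<Sum>j<M. \<Sum>k<M. c j * cnj (c k) * (\<Sum>i<M. root_of_unity M i ^ j * cnj (root_of_unity M i ^ k)))"
    unfolding sum_distrib_left by (subst sum.swap, rule sum.cong[OF refl], rule sum.swap)
  also have "\<dots> = (\<Sum>j<M. \<Sum>k<M. if j = k then c j * cnj (c k) * of_nat M else 0)"
    by (intro sum.cong refl, subst sum_root_of_unity_diff) auto
  also have "\<dots> = complex_of_real (real M * (\<Sum>j<M. (norm (c j))\<^sup>2))"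
    by (simp add: complex_norm_square sum_distrib_left mult_ac del: of_real_power)
  finally show ?thesis by (simp only: of_real_eq_iff)
qed

text \<open>The extremal example is the quadratic form of the discrete Fourier matrix in the $N$ primes
  up to $\sqrt x$, whose norm is at most $N^{3/2}$.\<close>

lemma bohr_admissible_card_primes:
  assumes x: "x \<ge> 2" and r: "r \<in> bohr_admissible x"
  shows "real (card {p::nat. prime p \<and> real p \<le> sqrt x}) * r ^ 4 \<le> 1"
proof -
  define P where "P = {p::nat. prime p \<and> real p \<le> sqrt x}"
  define N where "N = card P"
  have "P \<subseteq> {..nat \<lfloor>sqrt x\<rfloor>}" by (auto simp: P_def le_nat_floor)
  hence fP: "finite P" using finite_subset by blast
  obtain f where f: "bij_betw f {..<N} P"
    using ex_bij_betw_nat_finite[OF fP] unfolding N_def atLeast0LessThan by blast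
  have fp: "prime (f i)" "f i > 0" "real (f i) \<le> sqrt x" if "i < N" for i
  proof -
    have "f i \<in> P" using f that by (auto simp: bij_betw_def)
    thus "prime (f i)" "f i > 0" "real (f i) \<le> sqrt x" by (auto simp: P_def prime_gt_0_nat)
  qed
  have finj: "f i = f j \<longleftrightarrow> i = j" if "i < N" "j < N" for i j
    using f that by (auto simp: bij_betw_def inj_on_def)
  have pf: "prime_factorization (f i * f j) = {#f i, f j#}" if "i < N" "j < N" for i j
    using fp(1,2)[OF that(1)] fp(1,2)[OF that(2)]
    by (simp add: prime_factorization_mult prime_factorization_prime)
  define I where "I = {..<N} \<times> {..<N}"
  have fI: "finite I" by (simp add: I_def)
  define \<omega> where "\<omega> = (\<lambda>ij. root_of_unity N (fst ij) ^ snd ij)"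
  define h where "h = (\<lambda>ij. f (fst ij) * f (snd ij))"
  \<comment> \<open>The pairs (i, j) and (j, i) give the same monomial. As the Fourier matrix is
    symmetric, their entries agree and cannot cancel, so the moduli of the coefficients sum to
    N^2.\<close>
  define a where "a = (\<lambda>n. \<Sum>ij\<in>{ij \<in> I. h ij = n}. \<omega> ij)"
  have range: "h ` I \<subseteq> nats_upto x"
  proof (rule image_subsetI)
    fix ij assume "ij \<in> I"
    hence ij: "fst ij < N" "snd ij < N" by (auto simp: I_def)
    have "real (f (fst ij)) * real (f (snd ij)) \<le> sqrt x * sqrt x"
      using fp(3)[OF ij(1)] fp(3)[OF ij(2)] x by (intro mult_mono) auto
    thus "h ij \<in> nats_upto x"
      using fp(2)[OF ij(1)] fp(2)[OF ij(2)] x by (simp add: h_def nats_upto_def Suc_le_eq)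
  qed
  have norm_a: "norm (a n) * r ^ Omega n = (\<Sum>ij\<in>{ij \<in> I. h ij = n}. r\<^sup>2)" for n
  proof (cases "{ij \<in> I. h ij = n} = {}")
    case False
    then obtain i j where ij: "i < N" "j < N" "n = f i * f j" by (auto simp: I_def h_def)
    have Om: "Omega n = 2" by (simp add: Omega_def ij(3) pf[OF ij(1,2)])
    have "\<omega> kl = \<omega> (i, j)" if "kl \<in> {ij \<in> I. h ij = n}" for kl
    proof -
      obtain k l where kl': "kl = (k, l)" by (cases kl)
      hence kl: "kl = (k, l)" "k < N" "l < N" "f k * f l = f i * f j"
        using that ij by (auto simp: I_def h_def)
      have "{#f k, f l#} = {#f i, f j#}" using kl(4) pf[OF kl(2,3)] pf[OF ij(1,2)] by simp
      hence "(f k = f i \<and> f l = f j) \<or> (f k = f j \<and> f l = f i)"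
        by (auto simp: add_eq_conv_ex)
      hence "(k = i \<and> l = j) \<or> (k = j \<and> l = i)" using kl ij finj by auto
      thus ?thesis by (auto simp: \<omega>_def kl(1) root_of_unity_power mult.commute)
    qed
    hence "a n = of_nat (card {ij \<in> I. h ij = n}) * \<omega> (i, j)" by (simp add: a_def)
    hence "norm (a n) = real (card {ij \<in> I. h ij = n})"
      by (simp add: norm_mult \<omega>_def norm_power)
    thus ?thesis by (simp add: Om)
  next
    case True
    thus ?thesis unfolding a_def by (simp only: sum.empty) simp
  qed
  have "torus_bounded (nats_upto x) a (sqrt (real N ^ 3))"
    unfolding torus_bounded_def
  proof (intro allI impI)
    fix z :: "nat \<Rightarrow> complex" assume z: "\<forall>p. norm (z p) = 1"
    define S where "S = (\<lambda>i. \<Sum>j<N. z (f j) * root_of_unity N i ^ j)"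
    have "(\<Sum>n\<in>nats_upto x. a n * chi z n)
        = (\<Sum>n\<in>nats_upto x. \<Sum>ij\<in>{ij \<in> I. h ij = n}. \<omega> ij * chi z (h ij))"
      by (simp add: a_def sum_distrib_right)
    also have "\<dots> = (\<Sum>ij\<in>I. \<omega> ij * chi z (h ij))"
      using fI range by (intro sum.group finite_nats_upto) auto
    also have "\<dots> = (\<Sum>ij\<in>I. z (f (fst ij)) * (z (f (snd ij)) * \<omega> ij))"
      using fp by (intro sum.cong refl) (auto simp: h_def I_def chi_mult chi_prime)
    also have "\<dots> = (\<Sum>i<N. z (f i) * S i)"
      by (simp add: I_def S_def \<omega>_def sum_distrib_left sum.cartesian_product case_prod_unfold)
    finally have "(norm (\<Sum>n\<in>nats_upto x. a n * chi z n))\<^sup>2 = (norm (\<Sum>i<N. z (f i) * S i))\<^sup>2"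
      by simp
    also have "\<dots> \<le> real N * (\<Sum>i<N. (norm (z (f i) * S i))\<^sup>2)"
      using norm_sum_sq_le_card[of "\<lambda>i. z (f i) * S i" "{..<N}"] by simp
    also have "\<dots> = real N * (real N * (\<Sum>j<N. (norm (z (f j)))\<^sup>2))"
    proof -
      have "(\<Sum>i<N. (norm (S i))\<^sup>2) = real N * (\<Sum>j<N. (norm (z (f j)))\<^sup>2)"
        unfolding S_def by (rule root_of_unity_Parseval)
      thus ?thesis using z by (simp add: norm_mult)
    qed
    also have "\<dots> = real N ^ 3" using z by (simp add: power3_eq_cube)
    finally show "norm (\<Sum>n\<in>nats_upto x. a n * chi z n) \<le> sqrt (real N ^ 3)"
      by (rule real_le_rsqrt)
  qed
  hence "dirichlet_sup x a \<le> sqrt (real N ^ 3)" by (rule dirichlet_sup_le)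
  moreover have "(\<Sum>n\<in>nats_upto x. norm (a n) * r ^ Omega n) \<le> dirichlet_sup x a"
    using r by (simp add: bohr_admissible_def)
  moreover have "(\<Sum>n\<in>nats_upto x. norm (a n) * r ^ Omega n) = real (card I) * r\<^sup>2"
  proof -
    have "(\<Sum>n\<in>nats_upto x. \<Sum>ij\<in>{ij \<in> I. h ij = n}. r\<^sup>2) = (\<Sum>ij\<in>I. r\<^sup>2)"
      using fI range by (intro sum.group finite_nats_upto) auto
    thus ?thesis unfolding norm_a by simp
  qed
  ultimately have "real N ^ 2 * r\<^sup>2 \<le> sqrt (real N ^ 3)"
    by (simp add: I_def power2_eq_square)
  hence "(real N ^ 2 * r\<^sup>2)\<^sup>2 \<le> (sqrt (real N ^ 3))\<^sup>2" by (intro power_mono) auto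
  hence "real N ^ 3 * (real N * r ^ 4) \<le> real N ^ 3 * 1"
    by (simp add: power_mult_distrib power_numeral_reduce mult_ac)
  hence "real N * r ^ 4 \<le> 1" by (cases "N = 0") (simp_all add: mult_le_cancel_left_pos)
  thus ?thesis by (simp add: N_def P_def)
qed

lemma bohr_admissible_le_weight:
  assumes x: "x \<ge> 2" and r: "r \<in> bohr_admissible x"
  shows "r \<le> 2 * bohr_weight x"
proof -
  have r0: "r \<ge> 0" "r \<le> 1" using r bohr_admissible_le_1[OF x r] by (auto simp: bohr_admissible_def)
  have ln2: "ln 2 \<ge> (1/2 :: real)" using ln2_ge_two_thirds by simp
  have lnx: "ln x \<ge> 1/2" using ln2 x ln_le_cancel_iff[of 2 x] by linarith
  have "r ^ 4 \<le> 16 * (ln x / sqrt x)"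
  \<comment> \<open>Chebyshev's bound needs \<open>sqrt x \<ge> 2\<close>; on [2, 4) the weight is
    bounded below and \<open>r \<le> 1\<close> suffices. The 16 is 2^4.\<close>
  proof (cases "x \<ge> 4")
    case True
    define k where "k = real (card {p::nat. prime p \<and> real p \<le> sqrt x})"
    have sx: "sqrt x \<ge> 2" using True by (simp add: real_le_rsqrt)
    have "1/8 * sqrt x \<le> ln 2 / 4 * sqrt x" using ln2 x by (intro mult_right_mono) auto
    also have "\<dots> \<le> k * ln (sqrt x)" unfolding k_def by (rule prime_count_ge[OF sx])
    also have "\<dots> = k * (ln x / 2)" using x by (simp add: ln_sqrt)
    finally have "sqrt x \<le> 4 * k * ln x" by simp
    hence "sqrt x * r ^ 4 \<le> (4 * k * ln x) * r ^ 4" using r0 by (intro mult_right_mono) auto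
    also have "\<dots> = 4 * ln x * (k * r ^ 4)" by (simp add: mult_ac)
    also have "\<dots> \<le> 4 * ln x * 1"
      unfolding k_def using lnx by (intro mult_left_mono bohr_admissible_card_primes[OF x r]) auto
    also have "\<dots> \<le> 16 * ln x" using lnx by simp
    finally have "r ^ 4 * sqrt x \<le> 16 * ln x" by (simp add: mult.commute)
    moreover have "sqrt x > 0" using x by simp
    ultimately show ?thesis by (simp add: pos_le_divide_eq)
  next
    case False
    hence "sqrt x \<le> 2" by (simp add: real_le_lsqrt)
    hence "sqrt x \<le> 16 * ln x" using lnx by simp
    hence "1 \<le> 16 * (ln x / sqrt x)" using x by (simp add: field_simps)
    moreover have "r ^ 4 \<le> 1" using r0 by (simp add: power_le_one)
    ultimately show ?thesis by linarith
  qed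
  also have "\<dots> = (2 * bohr_weight x) ^ 4"
    using x by (simp add: power_mult_distrib bohr_weight_power4)
  finally show ?thesis
    using power_mono_iff[of r "2 * bohr_weight x" 4] r0 bohr_weight_nonneg by simp
qed

section \<open>From weights at n to the weight at x\<close>

text \<open>The quotient ln x / sqrt x decreases only beyond e^2, hence the factor 2. With x = u y,
  the growth of ln x = ln y + ln u is dominated by sqrt u because ln y is at least 1/2.\<close>

lemma bohr_weight_almost_antimono:
  assumes "2 \<le> y" "y \<le> x"
  shows "bohr_weight x \<le> 2 * bohr_weight y"
proof -
  have ln2: "ln 2 \<ge> (1/2 :: real)" using ln2_ge_two_thirds by simp
  have lny: "ln y \<ge> 1/2" using ln2 assms ln_le_cancel_iff[of 2 y] by linarith
  define u where "u = x / y"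
  have u: "u \<ge> 1" using assms by (simp add: u_def)
  hence su: "sqrt u \<ge> 1" by simp
  have "ln x = ln y + ln u" using assms by (simp add: u_def ln_div)
  moreover have "ln u \<le> 2 * sqrt u" using ln_powr_bound[of u "1/2"] u by (simp add: powr_half_sqrt)
  moreover have "1/2 * sqrt u \<le> ln y * sqrt u" using lny su by (intro mult_right_mono) auto
  moreover have "ln y * 1 \<le> ln y * sqrt u" using lny su by (intro mult_left_mono) auto
  ultimately have "ln x \<le> 5 * (ln y * sqrt u)" by linarith
  also have "\<dots> \<le> 16 * (ln y * sqrt u)" using lny su by (intro mult_right_mono) auto
  also have "\<dots> = 16 * (ln y / sqrt y) * sqrt x"
    using assms by (simp add: u_def real_sqrt_divide)
  finally have "bohr_weight x ^ 4 \<le> 16 * bohr_weight y ^ 4"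
    using assms by (simp add: bohr_weight_power4 pos_divide_le_eq)
  hence "bohr_weight x ^ 4 \<le> (2 * bohr_weight y) ^ 4" by (simp add: power_mult_distrib)
  thus ?thesis
    using power_mono_iff[of "bohr_weight x" "2 * bohr_weight y" 4] bohr_weight_nonneg by simp
qed

lemma dirichlet_Bohr_inequality:
  "\<exists>C>0. \<forall>x\<ge>2. \<forall>a. (\<Sum>n\<in>nats_upto x. norm (a n) * (C * bohr_weight (real n)) ^ Omega n) \<le> dirichlet_sup x a"
proof -
  obtain C where C: "C > 0" and bohr: "\<And>N X a B. X \<subseteq> {1..N} \<Longrightarrow> 1 \<in> X \<Longrightarrow> torus_bounded X a B \<Longrightarrow>
     (\<Sum>n\<in>X. norm (a n) * (C * bohr_weight (real n)) ^ Omega n) \<le> B"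
    using Bohr_inequality by blast
  have "(\<Sum>n\<in>nats_upto x. norm (a n) * (C * bohr_weight (real n)) ^ Omega n) \<le> dirichlet_sup x a"
    if "x \<ge> 2" for x a
  proof (rule bohr)
    show "nats_upto x \<subseteq> {1..nat \<lfloor>x\<rfloor>}" by (auto simp: nats_upto_def le_nat_floor)
    show "1 \<in> nats_upto x" using that by (simp add: nats_upto_def)
    show "torus_bounded (nats_upto x) a (dirichlet_sup x a)" by (rule torus_bounded_dirichlet_sup)
  qed
  thus ?thesis using C by blast
qed

lemma weight_in_bohr_admissible:
  assumes C: "C > 0" and x: "x \<ge> 2"
    and bohr: "\<And>a. (\<Sum>n\<in>nats_upto x. norm (a n) * (C * bohr_weight (real n)) ^ Omega n) \<le> dirichlet_sup x a"
  shows "C / 2 * bohr_weight x \<in> bohr_admissible x"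
  unfolding bohr_admissible_def
proof (intro CollectI conjI allI)
  show "0 \<le> C / 2 * bohr_weight x" using C bohr_weight_nonneg by simp
  fix a :: "nat \<Rightarrow> complex"
  have "(\<Sum>n\<in>nats_upto x. norm (a n) * (C / 2 * bohr_weight x) ^ Omega n)
      \<le> (\<Sum>n\<in>nats_upto x. norm (a n) * (C * bohr_weight (real n)) ^ Omega n)"
  proof (rule sum_mono)
    fix n assume n: "n \<in> nats_upto x"
    show "norm (a n) * (C / 2 * bohr_weight x) ^ Omega n
        \<le> norm (a n) * (C * bohr_weight (real n)) ^ Omega n"
    \<comment> \<open>The weight at 1 is 0, so the comparison of weights fails there; the exponent
      \<open>Omega 1 = 0\<close> makes both sides equal.\<close>
    proof (cases "n = 1")
      case False
      hence "bohr_weight x \<le> 2 * bohr_weight (real n)"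
        using n by (intro bohr_weight_almost_antimono) (auto simp: nats_upto_def)
      hence "C / 2 * bohr_weight x \<le> C / 2 * (2 * bohr_weight (real n))"
        using C by (intro mult_left_mono) auto
      hence "C / 2 * bohr_weight x \<le> C * bohr_weight (real n)" by simp
      thus ?thesis using C bohr_weight_nonneg by (intro mult_left_mono power_mono) auto
    qed simp
  qed
  thus "(\<Sum>n\<in>nats_upto x. norm (a n) * (C / 2 * bohr_weight x) ^ Omega n) \<le> dirichlet_sup x a"
    using bohr by (rule order_trans)
qed

theorem theorem2p1:
  shows "(\<forall>x\<ge>2. \<forall>a. dirichlet_sup x a = (SUP t::real. norm (dirichlet_poly x a (\<i> * of_real t)))) \<and>
         (\<exists>c>0. \<exists>C>0. \<forall>x\<ge>2.
           c * (ln x powr (1/4) / x powr (1/8)) \<le> dirichlet_bohr_radius x \<and>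
           dirichlet_bohr_radius x \<le> C * (ln x powr (1/4) / x powr (1/8))) \<and>
         (\<exists>C>0. \<forall>x\<ge>2. \<forall>a.
           (\<Sum>n\<in>nats_upto x. norm (a n) *
              (C * ln (real n) powr (1/4) / real n powr (1/8)) ^ Omega n)
             \<le> dirichlet_sup x a)"
proof -
  obtain C where C: "C > 0" and bohr: "\<And>x a. x \<ge> 2 \<Longrightarrow>
      (\<Sum>n\<in>nats_upto x. norm (a n) * (C * bohr_weight (real n)) ^ Omega n) \<le> dirichlet_sup x a"
    using dirichlet_Bohr_inequality by blast
  have lower: "C / 2 * bohr_weight x \<le> dirichlet_bohr_radius x" if "x \<ge> 2" for x
    unfolding dirichlet_bohr_radius_def
    using that C bohr bohr_admissible_le_1[OF that]
    by (intro cSup_upper weight_in_bohr_admissible) (auto intro!: bdd_aboveI[of _ 1])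
  have upper: "dirichlet_bohr_radius x \<le> 2 * bohr_weight x" if "x \<ge> 2" for x
    unfolding dirichlet_bohr_radius_def
    using zero_in_bohr_admissible[OF that] bohr_admissible_le_weight[OF that]
    by (intro cSup_least) auto
  have part2: "\<exists>c>0. \<exists>C>0. \<forall>x\<ge>2.
           c * (ln x powr (1/4) / x powr (1/8)) \<le> dirichlet_bohr_radius x \<and>
           dirichlet_bohr_radius x \<le> C * (ln x powr (1/4) / x powr (1/8))"
    using C lower upper unfolding bohr_weight_def
    by (intro exI[of _ "C / 2"] exI[of _ 2] conjI allI impI) auto
  have "C * bohr_weight (real n) = C * ln (real n) powr (1/4) / real n powr (1/8)" for n
    by (simp add: bohr_weight_def)
  hence part3: "\<exists>C>0. \<forall>x\<ge>2. \<forall>a.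
           (\<Sum>n\<in>nats_upto x. norm (a n) *
              (C * ln (real n) powr (1/4) / real n powr (1/8)) ^ Omega n)
             \<le> dirichlet_sup x a"
    using C bohr by (intro exI[of _ C] conjI allI impI) simp_all
  show ?thesis
    by (intro conjI part2 part3 allI impI dirichlet_sup_eq_vertical)
qed

end
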